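(* Let $0<\alpha<mn$, let $1<s\le\infty$ with conjugate exponent $s'$ (so $\frac1s+\frac1{s'}=1$) satisfying $1\le s'<\frac{mn}{\alpha}$, and let $\Omega$ be homogeneous of degree zero on $\mathbb{R}^{mn}$ with $\Omega\in L^{s}(S^{mn-1})$. Let $(u,\upsilon)$ be a pair of weights on $\mathbb{R}^n$, let $s'\le p_i\le q_i<\infty$ for each $i=1,\dots,m$, and let $\frac1p=\frac1{q_1}+\frac1{q_2}+\cdots+\frac1{q_m}$. If $$(u,\upsilon)\in\bigcap_{i=1}^m A^{\frac{\alpha s'}{m}}_{\frac{p_i}{s'},\frac{q_i}{s'}},$$ then there is a constant $C$ such that for every $f_i\in L^{p_i}_{\upsilon}(\mathbb{R}^n)$, $i=1,\dots,m$ (with $C$ independent of the $f_i$), $$\left\|M_{\Omega,\alpha}^{(m)}(\overrightarrow{f})\right\|_{L^{p,\infty}_{u}(\mathbb{R}^n)}\le C\prod_{i=1}^m\|f_i\|_{L^{p_i}_{\upsilon}(\mathbb{R}^n)}.$$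
   Context: $n\ge 2$ and $m\ge1$ are integers. Write $\overrightarrow{y}=(y_1,\dots,y_m)\in(\mathbb{R}^n)^m=\mathbb{R}^{mn}$, $d\overrightarrow{y}=dy_1\cdots dy_m$, $|\overrightarrow{y}|=|y_1|+\cdots+|y_m|$, and $\overrightarrow{f}=(f_1,\dots,f_m)$. $S^{mn-1}$ is the unit sphere of $\mathbb{R}^{mn}$ with surface measure. "$\Omega$ is homogeneous of degree zero" means $\Omega(\lambda\overrightarrow{y})=\Omega(\overrightarrow{y})$ for all $\lambda>0$, $\overrightarrow{y}\ne0$. The rough multi-sublinear fractional maximal operator is $$M_{\Omega,\alpha}^{(m)}(\overrightarrow{f})(x)=\sup_{r>0}\frac{1}{r^{mn-\alpha}}\int_{|\overrightarrow{y}|<r}|\Omega(\overrightarrow{y})|\prod_{i=1}^m|f_i(x-y_i)|\,d\overrightarrow{y},\qquad x\in\mathbb{R}^n.$$ A weight is a nonnegative locally integrable function on $\mathbb{R}^n$ that is positive a.e. For a weight $v$ and $0<p<\infty$, $\|g\|_{L^p_v}=\left(\int_{\mathbb{R}^n}|g|^p v\,dx\right)^{1/p}$ and $\|g\|_{L^{p,\infty}_v}=\sup_{\lambda>0}\lambda\, v(\{x:|g(x)|>\lambda\})^{1/p}$, where $v(E)=\int_E v\,dx$. For $1\le a\le b<\infty$ and $0\le\beta<n$, a pair of weights $(u,\upsilon)$ belongs to the class $A^{\beta}_{a,b}$ if there is a constant $C>0$ such that for every cube $Q\subset\mathbb{R}^n$ (sides parallel to the axes): when $a>1$ (with $a'=\frac{a}{a-1}$),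 $$|Q|^{\frac1b+\frac{\beta}{n}-\frac1a}\left(\frac1{|Q|}\int_Q u(x)\,dx\right)^{\frac1b}\left(\frac1{|Q|}\int_Q\upsilon(x)^{1-a'}dx\right)^{\frac1{a'}}\le C;$$ when $a=1$, $$|Q|^{\frac1b+\frac{\beta}{n}-1}\left(\frac1{|Q|}\int_Q u(x)\,dx\right)^{\frac1b}\le C\,\upsilon(x)\quad\text{for a.e. }x\in Q.$$ *)

theory Defs
  imports "HOL-Analysis.Analysis"
begin

text \<open>
  Points of \<open>(\<real>\<^sup>n)\<^sup>m = \<real>\<^sup>m\<^sup>n\<close> are values of type \<open>real^'n^'m\<close>: its \<open>norm\<close> is the Euclidean norm of
  \<open>\<real>\<^sup>m\<^sup>n\<close>, and \<open>y $ i\<close> is the \<open>i\<close>-th component \<open>y\<^sub>i\<close> in \<open>\<real>\<^sup>n\<close>. Functions are Lebesgue measurable and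
  all integrals of nonnegative functions are taken in \<open>[0,\<infinity>]\<close>.
\<close>

text \<open>Powers of elements of \<open>[0,\<infinity>]\<close>; only used with a positive exponent.\<close>

definition epowr :: "ennreal \<Rightarrow> real \<Rightarrow> ennreal" where
  "epowr t r = (if t = top then top else ennreal (enn2real t powr r))"

text \<open>
  Surface measure of the unit sphere, given on a Borel set \<open>E\<close> by
  \<open>\<sigma>(E) = N \<cdot> vol {x. 0 < |x| < 1 \<and> x / |x| \<in> E}\<close> with \<open>N\<close> the dimension of the ambient space, and then
  completed.
\<close>

definition sphere_measure :: "'a::euclidean_space measure" where
  "sphere_measure = completion (scale_measure (of_nat DIM('a))
     (distr (restrict_space lborel (ball 0 1 - {0})) (restrict_space borel (sphere 0 1))
       (\<lambda>x. x /\<^sub>R norm x)))"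

lemma emeasure_sphere_measure:
  fixes E :: "'a::euclidean_space set"
  assumes "E \<in> sets borel" "E \<subseteq> sphere 0 1"
  shows "emeasure sphere_measure E =
    of_nat DIM('a) * emeasure lborel {x. 0 < norm x \<and> norm x < 1 \<and> x /\<^sub>R norm x \<in> E}"
proof -
  let ?B = "ball 0 1 - {0::'a}"
  have meas: "(\<lambda>x::'a. x /\<^sub>R norm x) \<in> restrict_space lborel ?B \<rightarrow>\<^sub>M restrict_space borel (sphere 0 1)"
    by (intro measurable_restrict_space2 measurable_restrict_space1) (auto simp: space_restrict_space)
  have E: "E \<in> sets (restrict_space borel (sphere 0 1))"
    using assms by (subst sets_restrict_space_iff) auto
  have "(\<lambda>x::'a. x /\<^sub>R norm x) -` E \<inter> ?B = {x. 0 < norm x \<and> norm x < 1 \<and> x /\<^sub>R norm x \<in> E}"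
    by auto
  moreover have "emeasure (restrict_space lborel ?B) S = emeasure lborel S" if "S \<subseteq> ?B" for S
    using that by (intro emeasure_restrict_space) auto
  ultimately show ?thesis
    unfolding sphere_measure_def using E
    by (simp add: emeasure_distr[OF meas E] space_restrict_space subset_iff)
qed

definition Lp_space :: "ennreal \<Rightarrow> 'a measure \<Rightarrow> ('a \<Rightarrow> complex) set" where
  "Lp_space s M = {g \<in> borel_measurable M.
     if s = top then (\<exists>B::real. AE x in M. norm (g x) \<le> B)
     else (\<integral>\<^sup>+x. ennreal (norm (g x) powr enn2real s) \<partial>M) < top}"

definition homogeneous_deg_0 :: "('a::real_vector \<Rightarrow> 'b) \<Rightarrow> bool" where
  "homogeneous_deg_0 \<Omega> \<longleftrightarrow> (\<forall>t>0. \<forall>y. y \<noteq> 0 \<longrightarrow> \<Omega> (t *\<^sub>R y) = \<Omega> y)"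

definition weight :: "(real^'n \<Rightarrow> real) \<Rightarrow> bool" where
  "weight w \<longleftrightarrow> (\<forall>x. 0 \<le> w x) \<and> (AE x in lebesgue. 0 < w x) \<and>
     (\<forall>K. compact K \<longrightarrow> w absolutely_integrable_on K)"

definition weighted_Lp_norm :: "real \<Rightarrow> (real^'n \<Rightarrow> real) \<Rightarrow> (real^'n \<Rightarrow> complex) \<Rightarrow> ennreal" where
  "weighted_Lp_norm p w g =
     epowr (\<integral>\<^sup>+x. ennreal (norm (g x) powr p * w x) \<partial>lebesgue) (1 / p)"

definition weighted_Lp :: "real \<Rightarrow> (real^'n \<Rightarrow> real) \<Rightarrow> (real^'n \<Rightarrow> complex) set" where
  "weighted_Lp p w = {g \<in> borel_measurable lebesgue. weighted_Lp_norm p w g < top}"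

definition weighted_weak_Lp_norm :: "real \<Rightarrow> (real^'n \<Rightarrow> real) \<Rightarrow> (real^'n \<Rightarrow> ennreal) \<Rightarrow> ennreal" where
  "weighted_weak_Lp_norm p w g =
     (SUP t\<in>{0<..}. ennreal t * epowr (\<integral>\<^sup>+x\<in>{x. g x > ennreal t}. ennreal (w x) \<partial>lebesgue) (1 / p))"

definition is_cube :: "(real^'n) set \<Rightarrow> bool" where
  "is_cube Q \<longleftrightarrow> (\<exists>c l. 0 < l \<and> Q = cbox c (c + (\<chi> i. l)))"

definition average :: "(real^'n) set \<Rightarrow> (real^'n \<Rightarrow> real) \<Rightarrow> ennreal" where
  "average Q w = (\<integral>\<^sup>+x\<in>Q. ennreal (w x) \<partial>lebesgue) / emeasure lebesgue Q"

text \<open>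
  The two-weight class, for \<open>1 \<le> a \<le> b\<close> and \<open>0 \<le> \<beta> < n\<close>. For \<open>a > 1\<close> the conjugate exponent is
  \<open>a' = a / (a - 1)\<close>. The convention \<open>0 powr r = 0\<close> is immaterial in \<open>v x powr (1 - a')\<close>, since \<open>v\<close>
  vanishes only on a null set; if \<open>v powr (1 - a')\<close> is not integrable on \<open>Q\<close>, the average and hence the
  left-hand side are infinite.
\<close>

definition A_class :: "real \<Rightarrow> real \<Rightarrow> real \<Rightarrow> ((real^'n \<Rightarrow> real) \<times> (real^'n \<Rightarrow> real)) set" where
  "A_class \<beta> a b = {(u, v). weight u \<and> weight v \<and> (\<exists>C::real. 0 < C \<and> (\<forall>Q. is_cube Q \<longrightarrow>
     (a > 1 \<longrightarrow> (let a' = a / (a - 1) in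
        ennreal (measure lebesgue Q powr (1 / b + \<beta> / real CARD('n) - 1 / a))
          * epowr (average Q u) (1 / b) * epowr (average Q (\<lambda>x. v x powr (1 - a'))) (1 / a')
        \<le> ennreal C)) \<and>
     (a = 1 \<longrightarrow> (AE x in lebesgue. x \<in> Q \<longrightarrow>
        ennreal (measure lebesgue Q powr (1 / b + \<beta> / real CARD('n) - 1))
          * epowr (average Q u) (1 / b)
        \<le> ennreal (C * v x)))))}"

text \<open>The radius is measured by \<open>|y\<^sub>1| + \<dots> + |y\<^sub>m|\<close>, not by the Euclidean norm of \<open>y\<close>.\<close>

definition rough_frac_maximal ::
  "(real^'n^'m \<Rightarrow> complex) \<Rightarrow> real \<Rightarrow> ('m \<Rightarrow> real^'n \<Rightarrow> complex) \<Rightarrow> real^'n \<Rightarrow> ennreal" where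
  "rough_frac_maximal \<Omega> \<alpha> f x =
     (SUP r\<in>{0<..}. ennreal (1 / r powr (real CARD('m) * real CARD('n) - \<alpha>)) *
        (\<integral>\<^sup>+y\<in>{y. (\<Sum>i\<in>UNIV. norm (y $ i)) < r}.
           ennreal (norm (\<Omega> y) * (\<Prod>i\<in>UNIV. norm (f i (x - y $ i)))) \<partial>lebesgue))"

end

theory Submission imports Defs begin

text \<open>
  Hoelder's inequality splits off \<open>\<Omega>\<close>, whose \<open>L\<^sup>s\<close> norm over the ball of radius \<open>r\<close> scales like
  \<open>r\<close> to the power \<open>m n / s\<close> by homogeneity. The remaining average of the product of the
  \<open>|f\<^sub>i|\<close> to the power \<open>s'\<close> is at most the product over \<open>i\<close> of linear fractional averages of order
  \<open>\<alpha> s' / m\<close>. If this product is large then one of the factors is large, so the level set is covered by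
  level sets of the linear fractional maximal functions, at levels that may be chosen freely subject to
  a constraint on their product. Each of these is controlled by the \<open>A\<close> condition through the
  Vitali covering lemma.
\<close>

section \<open>Powers in the extended half-line and Hoelder's inequality\<close>

text \<open>The order \<open>\<alpha> * s' / m\<close> comes from sharing one power of the radius
  evenly. Hoelder's inequality leaves \<open>r powr (\<alpha> - m * n / s')\<close>, which is the
  \<open>1 / s'\<close>-th power of a product of \<open>m\<close> equal factors
  \<open>r powr (\<alpha> * s' / m - n)\<close>.

  When all norms \<open>A i\<close> of the functions are positive, the weak-type bound for the
  factor \<open>i\<close> at level \<open>\<tau> i powr s'\<close> has the form
  \<open>(c i * A i / \<tau> i) powr q_exp i\<close>. Setting all these bounds equal to one number
  \<open>\<theta>\<close> determines every \<open>\<tau> i\<close>, and requiring the product of the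
  \<open>\<tau> i\<close> to be \<open>t / K\<close> then determines \<open>\<theta>\<close>. The
  sum of the \<open>1 / q_exp i\<close> appears there as an exponent, and this is the origin of
  \<open>p\<close>. Since the same \<open>u\<close> measures every level set, the measures simply
  add.

  Measurability is the technical obstacle: \<open>\<Omega>\<close> is measurable only on the sphere
  for a completed measure and the functions are only Lebesgue measurable, whereas the integral over
  the power space is split for Borel functions. Borel versions therefore replace both
  beforehand.\<close>

lemma epowr_ennreal: "0 \<le> x \<Longrightarrow> epowr (ennreal x) r = ennreal (x powr r)"
  by (simp add: epowr_def)

lemma epowr_top [simp]: "epowr top r = top"
  by (simp add: epowr_def)

lemma epowr_0 [simp]: "epowr 0 r = 0"
  by (simp add: epowr_def)

lemma epowr_one_exp [simp]: "epowr x 1 = x"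
  by (cases x) (auto simp: epowr_def)

lemma epowr_eq_0_iff [simp]: "epowr x r = 0 \<longleftrightarrow> x = 0"
  by (cases x) (auto simp: epowr_def ennreal_eq_0_iff)

lemma epowr_eq_top_iff [simp]: "epowr x r = top \<longleftrightarrow> x = top"
  by (auto simp: epowr_def)

lemma epowr_mono: "x \<le> y \<Longrightarrow> 0 \<le> r \<Longrightarrow> epowr x r \<le> epowr y r"
  by (cases x; cases y) (auto simp: epowr_def intro!: ennreal_leI powr_mono2 simp: top_unique)

lemma epowr_1 [simp]: "epowr 1 r = 1"
  by (simp add: epowr_def)

text \<open>Holds for every real exponent because \<open>epowr\<close> fixes both \<open>0\<close>
  and \<open>top\<close>, so that the convention \<open>0 * top = 0\<close> is respected on both
  sides.\<close>

lemma epowr_mult: "epowr (x * y) r = epowr x r * epowr y r"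
proof (cases "x = top \<or> y = top")
  case True
  then show ?thesis by (auto simp: ennreal_top_mult ennreal_mult_top)
next
  case False
  then show ?thesis
    by (cases x; cases y) (auto simp: epowr_ennreal powr_mult simp flip: ennreal_mult)
qed

lemma epowr_epowr: "epowr (epowr x r) t = epowr x (r * t)"
  by (cases x) (auto simp: epowr_ennreal powr_powr)

lemma epowr_prod: "finite I \<Longrightarrow> epowr (\<Prod>i\<in>I. f i) r = (\<Prod>i\<in>I. epowr (f i) r)"
  by (induction I rule: finite_induct) (auto simp: epowr_mult)

lemma measurable_epowr [measurable (raw)]:
  "f \<in> borel_measurable M \<Longrightarrow> (\<lambda>x. epowr (f x) r) \<in> borel_measurable M"
  unfolding epowr_def by (measurable; simp add: pred_eq_const1)

lemma conjugate_exponent_gt_1: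
  fixes p q :: real
  assumes "1 < p" "1 / p + 1 / q = 1"
  shows "1 < q"
proof -
  have "1 / p < 1" "0 < 1 / p"
    using assms(1) by auto
  then have "0 < 1 / q" "1 / q < 1"
    using assms(2) by linarith+
  then show ?thesis
    by (simp add: divide_less_eq split: if_splits)
qed

text \<open>Young's inequality for \<open>x / P powr (1/p)\<close> and
  \<open>y / Q powr (1/q)\<close>. The normalisation of Hoelder's inequality is thereby built in:
  with \<open>P\<close> and \<open>Q\<close> the integrals of the two powers, the bracket integrates
  to \<open>1/p + 1/q = 1\<close>.\<close>

lemma Youngs_inequality_epowr:
  fixes x y :: ennreal and P Q :: real
  assumes "1 < p" "1 / p + 1 / q = 1" "0 < P" "0 < Q"
  shows "x * y \<le> ennreal (P powr (1/p) * Q powr (1/q)) *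
    (ennreal (1 / (p * P)) * epowr x p + ennreal (1 / (q * Q)) * epowr y q)"
proof -
  have q: "1 < q"
    using assms(1,2) by (rule conjugate_exponent_gt_1)
  show ?thesis
  proof (cases "x = top \<or> y = top")
    case True
    then show ?thesis using assms q
      by (auto simp: ennreal_mult_eq_top_iff ennreal_mult_top ennreal_top_mult)
  next
    case False
    then obtain a b where ab: "x = ennreal a" "0 \<le> a" "y = ennreal b" "0 \<le> b"
      by (cases x; cases y) auto
    define A where "A = P powr (1/p)"
    define B where "B = Q powr (1/q)"
    have A: "0 < A" "A powr p = P" and B: "0 < B" "B powr q = Q"
      using assms q by (auto simp: A_def B_def powr_powr)
    have "(a / A) * (b / B) \<le> (a / A) powr p / p + (b / B) powr q / q"
      using A B ab assms q by (intro Youngs_inequality) auto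
    also have "\<dots> = a powr p / (p * P) + b powr q / (q * Q)"
      using A B ab by (simp add: powr_divide mult.commute)
    finally have "a * b \<le> A * B * (a powr p / (p * P) + b powr q / (q * Q))"
      using A B by (simp add: field_simps)
    then show ?thesis using ab A B assms q
      by (simp add: epowr_ennreal flip: ennreal_mult ennreal_plus A_def B_def)
  qed
qed

lemma nn_integral_epowr_eq_0:
  assumes [measurable]: "f \<in> borel_measurable M" and "(\<integral>\<^sup>+x. epowr (f x) p \<partial>M) = 0"
  shows "AE x in M. f x = 0"
  using assms(2) by (simp add: nn_integral_0_iff_AE)

text \<open>The normalisation divides by both integrals, so the values \<open>0\<close> and
  \<open>top\<close> are separated first. A vanishing integral makes the product vanish almost
  everywhere, even if the other integral is infinite.\<close>

lemma Holder_nn_integral: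
  fixes f g :: "'a \<Rightarrow> ennreal"
  assumes p: "1 < p" "1 / p + 1 / q = 1"
    and [measurable]: "f \<in> borel_measurable M" "g \<in> borel_measurable M"
  shows "(\<integral>\<^sup>+x. f x * g x \<partial>M) \<le>
    epowr (\<integral>\<^sup>+x. epowr (f x) p \<partial>M) (1/p) * epowr (\<integral>\<^sup>+x. epowr (g x) q \<partial>M) (1/q)"
    (is "?L \<le> epowr ?P _ * epowr ?Q _")
proof -
  consider "?P = 0 \<or> ?Q = 0" | "?P \<noteq> 0" "?Q \<noteq> 0" "?P = top \<or> ?Q = top"
    | "?P \<noteq> 0" "?Q \<noteq> 0" "?P \<noteq> top" "?Q \<noteq> top" by blast
  then show ?thesis
  proof cases
    case 1
    then have "AE x in M. f x * g x = 0"
      using nn_integral_epowr_eq_0[of f M p] nn_integral_epowr_eq_0[of g M q] by fastforce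
    then have "?L = 0" by (subst nn_integral_0_iff_AE) auto
    then show ?thesis by simp
  next
    case 2
    then show ?thesis
      by (auto simp: ennreal_mult_top ennreal_top_mult)
  next
    case 3
    then obtain P Q where PQ: "?P = ennreal P" "?Q = ennreal Q" "0 < P" "0 < Q"
      by (cases ?P; cases ?Q) (auto simp: less_le)
    have q: "1 < q"
      using p by (rule conjugate_exponent_gt_1)
    have "?L \<le> (\<integral>\<^sup>+x. ennreal (P powr (1/p) * Q powr (1/q)) *
      (ennreal (1 / (p * P)) * epowr (f x) p + ennreal (1 / (q * Q)) * epowr (g x) q) \<partial>M)"
      using p PQ by (intro nn_integral_mono Youngs_inequality_epowr) auto
    also have "\<dots> = ennreal (P powr (1/p) * Q powr (1/q)) *
      (ennreal (1 / (p * P)) * ennreal P + ennreal (1 / (q * Q)) * ennreal Q)"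
      by (simp add: nn_integral_cmult nn_integral_add PQ)
    also have "ennreal (1 / (p * P)) * ennreal P + ennreal (1 / (q * Q)) * ennreal Q = ennreal (1 / p + 1 / q)"
      using PQ p q by (simp flip: ennreal_mult ennreal_plus)
    finally show ?thesis
      using PQ p by (simp add: epowr_ennreal ennreal_mult)
  qed
qed

section \<open>Lebesgue measure on a power of a Euclidean space\<close>

lemma nn_integral_lborel_affine:
  fixes t :: "'a::euclidean_space"
  assumes [measurable]: "f \<in> borel_measurable borel" and "c \<noteq> 0"
  shows "(\<integral>\<^sup>+x. f x \<partial>lborel) = ennreal (\<bar>c\<bar> ^ DIM('a)) * (\<integral>\<^sup>+x. f (t + c *\<^sub>R x) \<partial>lborel)"
  by (subst lborel_affine[OF \<open>c \<noteq> 0\<close>, of t])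
     (simp add: nn_integral_density nn_integral_distr nn_integral_cmult)

lemma AE_lborel_affine:
  fixes t :: "'a::euclidean_space"
  assumes "AE x in lborel. P x" and c: "c \<noteq> 0"
  shows "AE x in lborel. P (t + c *\<^sub>R x)"
proof -
  from assms(1) have "AE x in density (distr lborel borel (\<lambda>x. t + c *\<^sub>R x)) (\<lambda>_. ennreal (\<bar>c\<bar>^DIM('a))). P x"
    by (rule subst[of _ _ "\<lambda>M. AE x in M. P x", OF lborel_affine[OF c, of t]])
  then have "AE x in distr lborel borel (\<lambda>x. t + c *\<^sub>R x). P x"
    using c by (subst (asm) AE_density) auto
  then show ?thesis
    by (intro AE_distrD[of "\<lambda>x. t + c *\<^sub>R x" lborel borel]) auto
qed

text \<open>Two measures that agree on boxes coincide. The basis vectors of the power space are the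
  \<open>axis i c\<close> with \<open>c\<close> a basis vector of the factor, so the volume of a box
  is a double product. This opens the way to Tonelli's theorem over the components.\<close>

lemma lborel_vec_eq_distr_PiM:
  "(lborel :: ('a::euclidean_space^'m) measure) =
     distr (\<Pi>\<^sub>M i\<in>(UNIV::'m set). lborel) borel (\<lambda>y. \<chi> i. y i)"
proof (rule lborel_eqI)
  interpret product_sigma_finite "\<lambda>_::'m. lborel :: 'a measure"
    by standard
  have [measurable]: "(\<lambda>y. \<chi> i. y i) \<in> (\<Pi>\<^sub>M i\<in>(UNIV::'m set). (lborel :: 'a measure)) \<rightarrow>\<^sub>M borel"
    by (subst borel_measurable_euclidean_space) (auto simp: Basis_vec_def inner_axis)
  fix l u :: "'a^'m"
  assume le: "\<And>b. b \<in> Basis \<Longrightarrow> l \<bullet> b \<le> u \<bullet> b"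
  then have le': "\<And>i b. b \<in> Basis \<Longrightarrow> l $ i \<bullet> b \<le> u $ i \<bullet> b"
    by (force simp: Basis_vec_def inner_axis)
  have "(\<lambda>y. \<chi> i. y i) -` box l u \<inter> space (\<Pi>\<^sub>M i\<in>(UNIV::'m set). (lborel :: 'a measure))
      = (\<Pi>\<^sub>E i\<in>UNIV. box (l $ i) (u $ i))"
    by (auto simp: space_PiM mem_box Basis_vec_def inner_axis PiE_iff)
  then have "emeasure (distr (\<Pi>\<^sub>M i\<in>(UNIV::'m set). lborel) borel (\<lambda>y. \<chi> i. y i)) (box l u)
      = (\<Prod>i\<in>UNIV. emeasure lborel (box (l $ i) (u $ i)))"
    by (simp add: emeasure_distr emeasure_PiM)
  also have "\<dots> = (\<Prod>i\<in>UNIV. \<Prod>b\<in>Basis. ennreal ((u $ i - l $ i) \<bullet> b))"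
    using le' by (simp add: prod_ennreal inner_diff_left)
  also have "\<dots> = (\<Prod>b\<in>Basis. ennreal ((u - l) \<bullet> b))"
  proof -
    have "(Basis :: ('a^'m) set) = (\<lambda>p. axis (fst p) (snd p)) ` (UNIV \<times> (Basis :: 'a set))"
    proof (intro set_eqI iffI)
      fix b :: "'a^'m" assume "b \<in> (Basis :: ('a^'m) set)"
      then obtain i c where "b = axis i c" "c \<in> Basis" by (auto simp: Basis_vec_def)
      then show "b \<in> (\<lambda>p. axis (fst p) (snd p)) ` (UNIV \<times> (Basis :: 'a set))"
        by (intro image_eqI[of _ _ "(i, c)"]) auto
    qed (auto simp: Basis_vec_def; blast)
    then have "(\<Prod>b\<in>Basis. ennreal ((u - l) \<bullet> b)) =
        (\<Prod>b\<in>(\<lambda>p. axis (fst p) (snd p)) ` (UNIV \<times> (Basis :: 'a set)). ennreal ((u - l) \<bullet> b))"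
      by simp
    also have "\<dots> = (\<Prod>p\<in>UNIV \<times> Basis. ennreal ((u $ fst p - l $ fst p) \<bullet> snd p))"
      by (subst prod.reindex) (auto simp: inj_on_def axis_eq_axis nonzero_Basis inner_axis)
    finally show ?thesis
      by (simp add: prod.cartesian_product case_prod_unfold)
  qed
  finally show "emeasure (distr (\<Pi>\<^sub>M i\<in>(UNIV::'m set). lborel) borel (\<lambda>y. \<chi> i. y i)) (box l u)
      = ennreal (\<Prod>b\<in>Basis. (u - l) \<bullet> b)"
    using le by (simp add: prod_ennreal inner_diff_left)
qed simp

lemma nn_integral_lborel_vec_prod:
  fixes h :: "'m::finite \<Rightarrow> 'a::euclidean_space \<Rightarrow> ennreal"
  assumes [measurable]: "\<And>i. h i \<in> borel_measurable borel"
  shows "(\<integral>\<^sup>+y. (\<Prod>i\<in>UNIV. h i (y $ i)) \<partial>lborel) = (\<Prod>i\<in>UNIV. \<integral>\<^sup>+x. h i x \<partial>lborel)"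
proof -
  interpret product_sigma_finite "\<lambda>_::'m. lborel :: 'a measure"
    by standard
  have [measurable]: "(\<lambda>y. \<chi> i. y i) \<in> (\<Pi>\<^sub>M i\<in>(UNIV::'m set). (lborel :: 'a measure)) \<rightarrow>\<^sub>M borel"
    by (subst borel_measurable_euclidean_space) (auto simp: Basis_vec_def inner_axis)
  have [measurable]: "(\<lambda>y::'a^'m. y $ i) \<in> borel_measurable borel" for i
    by (intro borel_measurable_continuous_onI continuous_intros)
  show ?thesis
    by (subst lborel_vec_eq_distr_PiM) (simp add: nn_integral_distr product_nn_integral_prod)
qed

text \<open>The preimage of a null set under a coordinate is a cylinder, whose indicator is a
  product over the components. One factor has integral \<open>0\<close>, and this outweighs the
  infinite integrals of the remaining factors.\<close>

lemma AE_lborel_vec_nth: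
  assumes "AE x in (lborel :: 'a::euclidean_space measure). P x"
  shows "AE y in (lborel :: ('a^'m) measure). P (y $ i)"
proof -
  obtain N where N: "N \<in> null_sets lborel" "{x. \<not> P x} \<subseteq> N"
    using assms by (auto elim!: AE_E simp: null_sets_def)
  then have [measurable]: "N \<in> sets borel" by auto
  have [measurable]: "(\<lambda>y::'a^'m. y $ i) \<in> borel_measurable borel"
    by (intro borel_measurable_continuous_onI continuous_intros)
  define h where "h j = (if j = i then indicator N else (\<lambda>_. 1 :: ennreal))" for j
  have [measurable]: "h j \<in> borel_measurable borel" for j
    by (simp add: h_def)
  have "(\<Prod>j\<in>UNIV. h j (y $ j)) = indicator N (y $ i)" for y :: "'a^'m"
    by (subst prod.remove[of _ i]) (auto simp: h_def)
  then have "(\<integral>\<^sup>+y. indicator N ((y::'a^'m) $ i) \<partial>lborel) = (\<integral>\<^sup>+y. (\<Prod>j\<in>UNIV. h j ((y::'a^'m) $ j)) \<partial>lborel)"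
    by simp
  also have "\<dots> = (\<Prod>j\<in>UNIV. \<integral>\<^sup>+x. h j x \<partial>lborel)"
    by (rule nn_integral_lborel_vec_prod) measurable
  also have "\<dots> = 0"
    using N by (subst prod.remove[of _ i]) (auto simp: h_def)
  finally have "AE y::'a^'m in lborel. indicator N (y $ i) = (0::ennreal)"
    by (subst (asm) nn_integral_0_iff_AE) auto
  then show ?thesis
    by eventually_elim (use N(2) in \<open>auto split: split_indicator_asm\<close>)
qed

text \<open>If the norms of the components sum to less than \<open>r\<close>, each is below
  \<open>r\<close>. Enlarging the domain to this product of balls makes the integral factorise, and
  the reflection \<open>y \<mapsto> x - y\<close> moves the balls to \<open>x\<close>.\<close>

lemma nn_integral_prod_diff_le:
  fixes h :: "'m::finite \<Rightarrow> 'a::euclidean_space \<Rightarrow> ennreal"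
  assumes [measurable]: "\<And>i. h i \<in> borel_measurable borel"
  shows "(\<integral>\<^sup>+y\<in>{y. (\<Sum>i\<in>UNIV. norm (y $ i)) < r}. (\<Prod>i\<in>UNIV. h i (x - y $ i)) \<partial>lborel)
    \<le> (\<Prod>i\<in>UNIV. \<integral>\<^sup>+y\<in>ball x r. h i y \<partial>lborel)"
proof -
  have [measurable]: "ball x r \<in> sets borel"
    by simp
  have [measurable]: "(\<lambda>z. indicator (ball x r) (x - z) :: ennreal) \<in> borel_measurable borel"
    by (rule measurable_compose[where N=borel, OF _ borel_measurable_indicator]) auto
  have "norm (y $ i) < r" if "(\<Sum>i\<in>UNIV. norm (y $ i)) < r" for y :: "'a^'m" and i
    using that member_le_sum[of i UNIV "\<lambda>i. norm (y $ i)"] by auto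
  then have "(\<integral>\<^sup>+y\<in>{y. (\<Sum>i\<in>UNIV. norm (y $ i)) < r}. (\<Prod>i\<in>UNIV. h i (x - y $ i)) \<partial>lborel)
      \<le> (\<integral>\<^sup>+y. (\<Prod>i\<in>UNIV. h i (x - y $ i) * indicator (ball x r) (x - y $ i)) \<partial>lborel)"
    by (intro nn_integral_mono) (auto simp: dist_norm split: split_indicator)
  also have "\<dots> = (\<Prod>i\<in>UNIV. \<integral>\<^sup>+z. h i (x - z) * indicator (ball x r) (x - z) \<partial>lborel)"
    by (rule nn_integral_lborel_vec_prod) measurable
  also have "\<dots> = (\<Prod>i\<in>UNIV. \<integral>\<^sup>+y\<in>ball x r. h i y \<partial>lborel)"
    by (intro prod.cong refl) (subst (2) nn_integral_lborel_affine[where c="-1" and t=x], auto)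
  finally show ?thesis .
qed

text \<open>Dilation carries the null exceptional set in the unit ball to one in the ball of radius
  \<open>Suc k\<close>, and countably many such balls exhaust the space. The origin is a null set of
  its own.\<close>

lemma AE_lborel_homogeneous:
  assumes "AE y in lborel. y \<in> ball 0 1 - {0::'a::euclidean_space} \<longrightarrow> Q y"
    and hom: "\<And>t y. 0 < t \<Longrightarrow> y \<noteq> 0 \<Longrightarrow> Q (t *\<^sub>R y) \<longleftrightarrow> Q y"
  shows "AE y in lborel. Q y"
proof -
  have "AE y in lborel. y \<in> ball 0 (real (Suc k)) - {0} \<longrightarrow> Q y" for k
  proof -
    have "AE y in lborel. 0 + (1 / real (Suc k)) *\<^sub>R y \<in> ball 0 1 - {0::'a} \<longrightarrow>
        Q (0 + (1 / real (Suc k)) *\<^sub>R y)"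
      using assms(1) by (rule AE_lborel_affine) simp
    then show ?thesis
    proof eventually_elim
      case (elim y)
      then show ?case
        using hom[of "1 / real (Suc k)" y] by (auto simp: field_simps)
    qed
  qed
  then have "AE y in lborel. \<forall>k. y \<in> ball 0 (real (Suc k)) - {0} \<longrightarrow> Q y"
    unfolding AE_all_countable by blast
  moreover have "AE y in lborel. y \<noteq> (0::'a)"
    by (rule AE_lborel_singleton)
  ultimately show ?thesis
  proof eventually_elim
    case (elim y)
    obtain k where "norm y < real (Suc k)"
      by (meson reals_Archimedean2 less_trans of_nat_less_iff lessI)
    with elim show ?case by auto
  qed
qed

section \<open>Rough homogeneous kernels\<close>

lemma AE_scale_measureD:
  assumes "AE x in scale_measure r M. P x" "r \<noteq> 0"
  shows "AE x in M. P x"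
proof -
  obtain N where N: "{x \<in> space (scale_measure r M). \<not> P x} \<subseteq> N" "emeasure (scale_measure r M) N = 0"
    "N \<in> sets (scale_measure r M)"
    using assms(1) by (rule AE_E)
  then have "N \<in> null_sets M" "{x \<in> space M. \<not> P x} \<subseteq> N"
    using assms(2) by (auto simp: space_scale_measure)
  then show ?thesis by (rule AE_I')
qed

lemma measurable_radial_projection:
  "(\<lambda>x::'a::euclidean_space. x /\<^sub>R norm x) \<in>
     restrict_space lborel (ball 0 1 - {0}) \<rightarrow>\<^sub>M restrict_space borel (sphere 0 1)"
  by (intro measurable_restrict_space2 measurable_restrict_space1) (auto simp: space_restrict_space)

text \<open>A Borel subset of the sphere is null exactly when the cone over it in the unit ball is
  null; this is how \<open>sphere_measure\<close> is built, and completing it adds only subsets of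
  such sets.\<close>

lemma AE_sphere_measureD:
  assumes "AE x in (sphere_measure :: 'a::euclidean_space measure). P x"
  shows "AE y in (lborel :: 'a measure). y \<in> ball 0 1 - {0} \<longrightarrow> P (y /\<^sub>R norm y)"
proof -
  have "AE x in distr (restrict_space lborel (ball 0 1 - {0})) (restrict_space borel (sphere 0 1))
       (\<lambda>x::'a. x /\<^sub>R norm x). P x"
    using assms unfolding sphere_measure_def AE_completion_iff
    by (rule AE_scale_measureD) simp
  from AE_distrD[OF measurable_radial_projection this] show ?thesis
    by (subst (asm) AE_restrict_space_iff) auto
qed

text \<open>Measurability of \<open>\<Omega>\<close> is given only on the sphere and up to null
  sets. A Borel version chosen there and extended along rays is homogeneous everywhere and agrees
  with the modulus of \<open>\<Omega>\<close> almost everywhere in the whole space.\<close>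

lemma homogeneous_borel_version:
  fixes \<Omega> :: "'a::euclidean_space \<Rightarrow> complex"
  assumes hom: "homogeneous_deg_0 \<Omega>" and meas: "\<Omega> \<in> borel_measurable sphere_measure"
  obtains W :: "'a \<Rightarrow> ennreal" where "W \<in> borel_measurable borel"
    "\<And>t y. 0 < t \<Longrightarrow> W (t *\<^sub>R y) = W y"
    "AE y in lborel. ennreal (norm (\<Omega> y)) = W y"
    "\<And>s. (\<integral>\<^sup>+x. ennreal (norm (\<Omega> x) powr s) \<partial>sphere_measure) =
       of_nat DIM('a) * (\<integral>\<^sup>+y\<in>ball 0 1. epowr (W y) s \<partial>lborel)"
proof -
  define \<nu> where "\<nu> = distr (restrict_space lborel (ball 0 1 - {0})) (restrict_space borel (sphere 0 1))
       (\<lambda>x::'a. x /\<^sub>R norm x)"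
  have \<sigma>: "sphere_measure = completion (scale_measure (of_nat DIM('a)) \<nu>)"
    unfolding sphere_measure_def \<nu>_def ..
  have "(\<lambda>x. ennreal (norm (\<Omega> x))) \<in> borel_measurable (completion (scale_measure (of_nat DIM('a)) \<nu>))"
    using meas unfolding \<sigma> by measurable
  from completion_ex_borel_measurable[OF this] obtain w
    where w: "w \<in> borel_measurable (scale_measure (of_nat DIM('a)) \<nu>)"
      and ae: "AE x in scale_measure (of_nat DIM('a)) \<nu>. ennreal (norm (\<Omega> x)) = w x"
    by blast
  have w\<nu>: "w \<in> borel_measurable \<nu>"
    using w by (simp cong: measurable_cong_sets)
  then have w': "w \<in> borel_measurable (restrict_space borel (sphere 0 1))"
    by (simp add: \<nu>_def)
  then have [measurable]: "(\<lambda>x. w x * indicator (sphere 0 1) x) \<in> borel_measurable borel"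
    by (subst (asm) borel_measurable_restrict_space_iff_ennreal) auto
  \<comment> \<open>At the origin \<open>y /\<^sub>R norm y\<close> is \<open>0\<close>, which is
    off the sphere; the indicator gives \<open>W 0 = 0\<close>, and homogeneity has no exceptional
    point. It also extends \<open>w\<close>, measurable on the sphere only, to a Borel
    function.\<close>
  define W where "W y = w (y /\<^sub>R norm y) * indicator (sphere 0 1) (y /\<^sub>R norm y)" for y :: 'a
  have W: "W y = w (y /\<^sub>R norm y)" if "y \<noteq> 0" for y
    using that by (simp add: W_def)
  show thesis
  proof (rule that[of W])
    show "W \<in> borel_measurable borel"
      unfolding W_def
      by (rule measurable_compose[where f="\<lambda>y. y /\<^sub>R norm y" and N=borel]) measurable
    show Whom: "W (t *\<^sub>R y) = W y" if "0 < t" for t y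
    proof -
      have "(t *\<^sub>R y) /\<^sub>R norm (t *\<^sub>R y) = y /\<^sub>R norm y"
        using that by (simp add: mult.commute)
      then show ?thesis
        by (simp only: W_def)
    qed
    have "AE x in sphere_measure. ennreal (norm (\<Omega> x)) = w x"
      unfolding \<sigma> AE_completion_iff by (rule ae)
    then have "AE y in (lborel :: 'a measure). y \<in> ball 0 1 - {0} \<longrightarrow>
        ennreal (norm (\<Omega> (y /\<^sub>R norm y))) = w (y /\<^sub>R norm y)"
      by (rule AE_sphere_measureD)
    then have "AE y in (lborel :: 'a measure). y \<in> ball 0 1 - {0} \<longrightarrow> ennreal (norm (\<Omega> y)) = W y"
    proof eventually_elim
      case (elim y)
      show ?case
      proof
        assume y: "y \<in> ball 0 1 - {0}"
        then have "\<Omega> (y /\<^sub>R norm y) = \<Omega> y"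
          using hom unfolding homogeneous_deg_0_def by simp
        with elim y show "ennreal (norm (\<Omega> y)) = W y"
          by (simp add: W)
      qed
    qed
    then show "AE y in lborel. ennreal (norm (\<Omega> y)) = W y"
      by (rule AE_lborel_homogeneous) (use hom Whom in \<open>auto simp: homogeneous_deg_0_def\<close>)
    fix s
    \<comment> \<open>In polar coordinates the integrand is constant along rays and the radial
      integral is \<open>1 / DIM('a)\<close>. Here the same follows by unfolding the push-forward
      that defines the measure.\<close>
    have "(\<integral>\<^sup>+x. ennreal (norm (\<Omega> x) powr s) \<partial>sphere_measure)
        = (\<integral>\<^sup>+x. epowr (w x) s \<partial>scale_measure (of_nat DIM('a)) \<nu>)"
      unfolding \<sigma> nn_integral_completion
      using ae by (intro nn_integral_cong_AE, eventually_elim) (simp flip: epowr_ennreal)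
    also have "\<dots> = of_nat DIM('a) * (\<integral>\<^sup>+x. epowr (w x) s \<partial>\<nu>)"
      using w\<nu> by (intro nn_integral_scale_measure) measurable
    also have "(\<integral>\<^sup>+x. epowr (w x) s \<partial>\<nu>)
        = (\<integral>\<^sup>+y. epowr (w (y /\<^sub>R norm y)) s \<partial>restrict_space lborel (ball 0 1 - {0}))"
      unfolding \<nu>_def using w' by (intro nn_integral_distr measurable_radial_projection) measurable
    also have "\<dots> = (\<integral>\<^sup>+y. epowr (w (y /\<^sub>R norm y)) s * indicator (ball 0 1 - {0}) y \<partial>lborel)"
      by (rule nn_integral_restrict_space) auto
    also have "\<dots> = (\<integral>\<^sup>+y\<in>ball 0 1. epowr (W y) s \<partial>lborel)"
      by (intro nn_integral_cong) (auto simp: W_def split: split_indicator)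
    finally show "(\<integral>\<^sup>+x. ennreal (norm (\<Omega> x) powr s) \<partial>sphere_measure) =
       of_nat DIM('a) * (\<integral>\<^sup>+y\<in>ball 0 1. epowr (W y) s \<partial>lborel)" .
  qed
qed

text \<open>For finite \<open>s\<close>, dilation and homogeneity give the integral of the
  \<open>s\<close>-th power over the ball of radius \<open>r\<close> as \<open>r ^ DIM('a)\<close>
  times the one over the unit ball, and \<open>1 / s = 1 - 1 / s'\<close>. For
  \<open>s = top\<close> the kernel is essentially bounded, \<open>s' = 1\<close>, and the power of
  \<open>r\<close> is \<open>1\<close>.\<close>

lemma rough_kernel_Holder:
  fixes \<Omega> :: "'a::euclidean_space \<Rightarrow> complex"
  assumes hom: "homogeneous_deg_0 \<Omega>" and \<Omega>: "\<Omega> \<in> Lp_space s sphere_measure"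
    and s: "1 < s" "1 / s + 1 / ennreal s' = 1" "1 \<le> s'"
  obtains K :: real where "0 < K"
    "\<And>r F. 0 < r \<Longrightarrow> F \<in> borel_measurable borel \<Longrightarrow>
      (\<integral>\<^sup>+y\<in>ball 0 r. ennreal (norm (\<Omega> y)) * F y \<partial>lborel)
        \<le> ennreal (K * r powr (real DIM('a) * (1 - 1 / s'))) * epowr (\<integral>\<^sup>+y. epowr (F y) s' \<partial>lborel) (1 / s')"
proof (cases "s = top")
  case True
  have "1 / ennreal s' = ennreal (1 / s')"
    using s(3) by (simp add: divide_ennreal flip: ennreal_1)
  then have s': "s' = 1"
    using s True by (simp flip: ennreal_1)
  obtain B where B: "AE x in sphere_measure. norm (\<Omega> x) \<le> B"
    using \<Omega> True by (auto simp: Lp_space_def)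
  have "AE y in lborel. norm (\<Omega> y) \<le> B"
  proof (rule AE_lborel_homogeneous)
    show "AE y in lborel. y \<in> ball 0 1 - {0} \<longrightarrow> norm (\<Omega> y) \<le> B"
      using AE_sphere_measureD[OF B]
      by eventually_elim (use hom in \<open>auto simp: homogeneous_deg_0_def\<close>)
  qed (use hom in \<open>auto simp: homogeneous_deg_0_def\<close>)
  then have ae: "AE y in lborel. norm (\<Omega> y) \<le> max B 1"
    by eventually_elim simp
  show thesis
  proof (rule that[of "max B 1"])
    fix r :: real and F :: "'a \<Rightarrow> ennreal"
    assume r: "0 < r" and [measurable]: "F \<in> borel_measurable borel"
    have "(\<integral>\<^sup>+y\<in>ball 0 r. ennreal (norm (\<Omega> y)) * F y \<partial>lborel) \<le> (\<integral>\<^sup>+y. ennreal (max B 1) * F y \<partial>lborel)"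
      using ae by (intro nn_integral_mono_AE, eventually_elim)
        (auto split: split_indicator intro!: mult_right_mono ennreal_leI)
    also have "\<dots> = ennreal (max B 1) * (\<integral>\<^sup>+y. F y \<partial>lborel)"
      by (simp add: nn_integral_cmult)
    finally show "(\<integral>\<^sup>+y\<in>ball 0 r. ennreal (norm (\<Omega> y)) * F y \<partial>lborel)
        \<le> ennreal (max B 1 * r powr (real DIM('a) * (1 - 1 / s'))) * epowr (\<integral>\<^sup>+y. epowr (F y) s' \<partial>lborel) (1 / s')"
      using r by (simp add: s')
  qed simp
next
  case False
  then obtain S where S: "s = ennreal S" "1 < S"
    using s(1) by (cases s) auto
  have conj: "1 / S + 1 / s' = 1"
  proof -
    have "1 / s + 1 / ennreal s' = ennreal (1 / S + 1 / s')"
      using S s(3) by (simp add: divide_ennreal flip: ennreal_1 ennreal_plus)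
    then have "ennreal (1 / S + 1 / s') = ennreal 1"
      using s(2) by simp
    then show ?thesis
      using S s(3) by (subst (asm) ennreal_inj) auto
  qed
  obtain W where [measurable]: "W \<in> borel_measurable borel"
    and Whom: "\<And>t y. 0 < t \<Longrightarrow> W (t *\<^sub>R y) = W y"
    and ae: "AE y in lborel. ennreal (norm (\<Omega> y)) = W y"
    and W: "\<And>s. (\<integral>\<^sup>+x. ennreal (norm (\<Omega> x) powr s) \<partial>sphere_measure) =
       of_nat DIM('a) * (\<integral>\<^sup>+y\<in>ball 0 1. epowr (W y) s \<partial>lborel)"
    using homogeneous_borel_version[OF hom] \<Omega> unfolding Lp_space_def by blast
  have "(\<integral>\<^sup>+x. ennreal (norm (\<Omega> x) powr S) \<partial>sphere_measure) < top"
    using \<Omega> S by (simp add: Lp_space_def)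
  then have "(\<integral>\<^sup>+y\<in>ball 0 1. epowr (W y) S \<partial>lborel) < top"
    unfolding W by (auto simp: ennreal_mult_less_top)
  then obtain I where I: "(\<integral>\<^sup>+y\<in>ball 0 1. epowr (W y) S \<partial>lborel) = ennreal I" "0 \<le> I"
    by (cases "\<integral>\<^sup>+y\<in>ball 0 1. epowr (W y) S \<partial>lborel") auto
  have ball_meas: "ball (0::'a) r \<in> sets borel" for r
    by simp
  note [measurable] = ball_meas
  have scale: "(\<integral>\<^sup>+y\<in>ball 0 r. epowr (W y) S \<partial>lborel) = ennreal (r ^ DIM('a)) * ennreal I" if "0 < r" for r
  proof -
    have "(\<integral>\<^sup>+y\<in>ball 0 r. epowr (W y) S \<partial>lborel) = ennreal (r ^ DIM('a)) *
        (\<integral>\<^sup>+y. epowr (W (0 + r *\<^sub>R y)) S * indicator (ball 0 r) (0 + r *\<^sub>R y) \<partial>lborel)"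
      using that by (subst nn_integral_lborel_affine[of _ r 0]) auto
    also have "(\<integral>\<^sup>+y. epowr (W (0 + r *\<^sub>R y)) S * indicator (ball 0 r) (0 + r *\<^sub>R y) \<partial>lborel)
        = (\<integral>\<^sup>+y\<in>ball 0 1. epowr (W y) S \<partial>lborel)"
      using that by (intro nn_integral_cong) (auto simp: Whom split: split_indicator)
    finally show ?thesis by (simp add: I)
  qed
  show thesis
  \<comment> \<open>The summand \<open>1\<close> keeps the constant positive for a kernel that
    vanishes almost everywhere; the final choice of levels divides by it.\<close>
  proof (rule that[of "I powr (1 / S) + 1"])
    show "0 < I powr (1 / S) + 1"
      by (simp add: add_nonneg_pos)
    fix r :: real and F :: "'a \<Rightarrow> ennreal"
    assume r: "0 < r" and [measurable]: "F \<in> borel_measurable borel"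
    have "(\<integral>\<^sup>+y\<in>ball 0 r. ennreal (norm (\<Omega> y)) * F y \<partial>lborel)
        = (\<integral>\<^sup>+y. (W y * indicator (ball 0 r) y) * F y \<partial>lborel)"
      using ae by (intro nn_integral_cong_AE, eventually_elim) (simp add: mult_ac)
    also have "\<dots> \<le> epowr (\<integral>\<^sup>+y. epowr (W y * indicator (ball 0 r) y) S \<partial>lborel) (1 / S)
        * epowr (\<integral>\<^sup>+y. epowr (F y) s' \<partial>lborel) (1 / s')"
      using S conj by (intro Holder_nn_integral) measurable
    also have "(\<integral>\<^sup>+y. epowr (W y * indicator (ball 0 r) y) S \<partial>lborel)
        = (\<integral>\<^sup>+y\<in>ball 0 r. epowr (W y) S \<partial>lborel)"
      by (intro nn_integral_cong) (auto split: split_indicator)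
    also have "\<dots> = ennreal (r powr real DIM('a) * I)"
      using r I by (simp add: scale powr_realpow flip: ennreal_mult)
    also have "epowr (ennreal (r powr real DIM('a) * I)) (1 / S)
        = ennreal (r powr (real DIM('a) * (1 - 1 / s')) * I powr (1 / S))"
    proof -
      have "1 / S = 1 - 1 / s'" using conj by simp
      then show ?thesis
        using I r by (simp add: epowr_ennreal powr_mult powr_powr)
    qed
    also have "\<dots> \<le> ennreal ((I powr (1 / S) + 1) * r powr (real DIM('a) * (1 - 1 / s')))"
      by (intro ennreal_leI) (simp add: algebra_simps)
    finally show "(\<integral>\<^sup>+y\<in>ball 0 r. ennreal (norm (\<Omega> y)) * F y \<partial>lborel)
        \<le> ennreal ((I powr (1 / S) + 1) * r powr (real DIM('a) * (1 - 1 / s')))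
          * epowr (\<integral>\<^sup>+y. epowr (F y) s' \<partial>lborel) (1 / s')"
      by (simp add: mult_right_mono)
  qed
qed

section \<open>The weak-type estimate for the fractional maximal function\<close>

text \<open>Integrability is available on compact sets only, so \<open>w\<close> is recovered as the
  limit of its truncations to balls.\<close>

lemma weight_borel_measurable:
  fixes w :: "real^'n \<Rightarrow> real"
  assumes "weight w"
  shows "w \<in> borel_measurable lebesgue"
proof (rule borel_measurable_LIMSEQ_real)
  fix x :: "real^'n"
  obtain N where "norm x < real N" using reals_Archimedean2 by blast
  then have "\<forall>\<^sub>F k in sequentially. indicator (cball 0 (real k)) x *\<^sub>R w x = w x"
    by (intro eventually_sequentiallyI[of N]) (auto split: split_indicator)
  then show "(\<lambda>k. indicator (cball 0 (real k)) x *\<^sub>R w x) \<longlonglongrightarrow> w x"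
    by (rule tendsto_eventually)
next
  fix k
  have "w absolutely_integrable_on cball 0 (real k)"
    using assms unfolding weight_def by (meson compact_cball)
  then show "(\<lambda>x. indicator (cball 0 (real k)) x *\<^sub>R w x) \<in> borel_measurable lebesgue"
    unfolding set_integrable_def by (rule borel_measurable_integrable)
qed

section \<open>The two-weight condition on balls\<close>

lemma epowr_divide_ennreal:
  "0 < L \<Longrightarrow> epowr (x / ennreal L) t = epowr x t * ennreal (L powr (- t))"
  by (simp add: divide_ennreal_def inverse_ennreal epowr_mult epowr_ennreal powr_divide powr_minus_divide
    inverse_eq_divide)

lemma nn_integral_mono_set:
  assumes "A \<subseteq> B"
  shows "(\<integral>\<^sup>+x\<in>A. f x \<partial>M) \<le> (\<integral>\<^sup>+x\<in>B. f x \<partial>M)"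
  using assms by (intro nn_integral_mono) (auto split: split_indicator)

text \<open>The cube is centred at \<open>x\<close> with half side \<open>5 * r\<close>. A single
  cube contains both balls, so one instance of the \<open>A\<close> condition controls
  \<open>u\<close> on the large ball and \<open>v\<close> on the small one.\<close>

lemma ball_subset_cube:
  fixes x :: "real^'n"
  assumes "0 < r"
  obtains Q where "is_cube Q" "cball x r \<subseteq> Q" "ball x (5 * r) \<subseteq> Q"
    "measure lebesgue Q = (10 * r) ^ CARD('n)" "emeasure lebesgue Q = ennreal ((10 * r) ^ CARD('n))"
proof -
  define c :: "real^'n" where "c = (\<chi> i. x $ i - 5 * r)"
  define Q where "Q = cbox c (c + (\<chi> i. 10 * r))"
  have cube: "is_cube Q"
    using assms unfolding is_cube_def Q_def by (intro exI[of _ c] exI[of _ "10 * r"]) auto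
  have sub: "ball x (5 * r) \<subseteq> Q"
  proof
    fix y assume "y \<in> ball x (5 * r)"
    then have "\<bar>x $ i - y $ i\<bar> < 5 * r" for i
      using component_le_norm_cart[of "x - y" i] by (auto simp: dist_norm)
    then have "x $ i - y $ i < 5 * r" "y $ i - x $ i < 5 * r" for i
      by (auto simp: abs_less_iff)
    then show "y \<in> Q"
      unfolding Q_def c_def mem_box_cart by (auto simp: algebra_simps) (smt (verit))+
  qed
  then have sub': "cball x r \<subseteq> Q"
    using assms by (auto simp: subset_iff)
  have prod: "(\<Prod>b\<in>Basis. ((\<chi> i. 10 * r) :: real^'n) \<bullet> b) = (10 * r) ^ CARD('n)"
  proof -
    have "((\<chi> i. 10 * r) :: real^'n) \<bullet> b = 10 * r" if "b \<in> Basis" for b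
      using that by (auto simp: Basis_vec_def inner_axis)
    then show ?thesis by simp
  qed
  have le: "c \<bullet> b \<le> (c + (\<chi> i. 10 * r)) \<bullet> b" if "b \<in> Basis" for b
    using that assms by (auto simp: Basis_vec_def inner_axis)
  have em: "emeasure lebesgue Q = ennreal ((10 * r) ^ CARD('n))"
    unfolding Q_def by (simp add: emeasure_lborel_cbox le prod)
  then have "measure lebesgue Q = (10 * r) ^ CARD('n)"
    using assms by (simp add: measure_def)
  with that cube sub sub' em show thesis by blast
qed

text \<open>
  Only \<open>u\<close> is integrated over the ball of radius \<open>5 * r\<close>: this asymmetry replaces a doubling
  property of \<open>u\<close> in the Vitali covering argument.
\<close>

lemma A_class_ball:
  fixes u v :: "real^'n \<Rightarrow> real"
  assumes uv: "(u, v) \<in> A_class \<beta> a b" and b: "0 < b"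
  shows "\<exists>C>0.
    (\<forall>q x r. 1 < a \<longrightarrow> 1 / a + 1 / q = 1 \<longrightarrow> 0 < r \<longrightarrow>
      ennreal (r powr (\<beta> - real CARD('n))) * epowr (\<integral>\<^sup>+y\<in>ball x (5 * r). ennreal (u y) \<partial>lebesgue) (1 / b)
        * epowr (\<integral>\<^sup>+y\<in>cball x r. ennreal (v y powr (1 - q)) \<partial>lebesgue) (1 / q) \<le> ennreal C) \<and>
    (\<forall>x r. a = 1 \<longrightarrow> 0 < r \<longrightarrow>
      (AE y in lebesgue. y \<in> cball x r \<longrightarrow> ennreal (r powr (\<beta> - real CARD('n)))
        * epowr (\<integral>\<^sup>+y\<in>ball x (5 * r). ennreal (u y) \<partial>lebesgue) (1 / b) \<le> ennreal (C * v y)))"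
proof -
  define n where "n = real CARD('n)"
  have n: "0 < n" by (simp add: n_def)
  obtain C where C: "0 < C"
    and C1: "\<And>Q. is_cube Q \<Longrightarrow> a > 1 \<Longrightarrow>
        ennreal (measure lebesgue Q powr (1 / b + \<beta> / n - 1 / a))
          * epowr (average Q u) (1 / b) * epowr (average Q (\<lambda>x. v x powr (1 - a / (a - 1)))) (1 / (a / (a - 1)))
        \<le> ennreal C"
    and C2: "\<And>Q. is_cube Q \<Longrightarrow> a = 1 \<Longrightarrow> AE x in lebesgue. x \<in> Q \<longrightarrow>
        ennreal (measure lebesgue Q powr (1 / b + \<beta> / n - 1)) * epowr (average Q u) (1 / b) \<le> ennreal (C * v x)"
    using uv unfolding A_class_def n_def[symmetric] by (auto simp: Let_def)
  \<comment> \<open>The cube has measure \<open>(10 * r) powr n\<close>, so \<open>D\<close> is the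
    ratio of \<open>r powr (\<beta> - n)\<close> to the power \<open>\<beta> / n - 1\<close> of that
    measure.\<close>
  define D where "D = 10 powr (n - \<beta>)"
  have D: "0 < D" by (simp add: D_def)
  have L: "ennreal (r powr (\<beta> - n)) = ennreal D * ennreal (((10 * r) ^ CARD('n)) powr (\<beta> / n - 1))"
    if "0 < r" for r :: real
  proof -
    have "((10 * r) ^ CARD('n)) powr (\<beta> / n - 1) = ((10 * r) powr n) powr (\<beta> / n - 1)"
      using that by (simp add: n_def powr_realpow)
    also have "\<dots> = (10 * r) powr (\<beta> - n)"
    proof -
      have "n * (\<beta> / n - 1) = \<beta> - n" using n by (simp add: field_simps)
      then show ?thesis by (simp add: powr_powr)
    qed
    also have "\<dots> = 10 powr (\<beta> - n) * r powr (\<beta> - n)"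
      using that by (simp add: powr_mult)
    finally have "D * ((10 * r) ^ CARD('n)) powr (\<beta> / n - 1) = (D * 10 powr (\<beta> - n)) * r powr (\<beta> - n)"
      by simp
    also have "D * 10 powr (\<beta> - n) = 1"
      by (simp add: D_def flip: powr_add)
    finally have "D * ((10 * r) ^ CARD('n)) powr (\<beta> / n - 1) = r powr (\<beta> - n)"
      by simp
    then show ?thesis
      using D by (metis ennreal_mult' less_imp_le)
  qed
  have avg: "average Q w = (\<integral>\<^sup>+x\<in>Q. ennreal (w x) \<partial>lebesgue) / emeasure lebesgue Q"
    for Q and w :: "real^'n \<Rightarrow> real"
    by (rule average_def)
  show ?thesis
  proof (intro exI[of _ "D * C"] conjI allI impI)
    show "0 < D * C" using C D by simp
  next
    fix q r :: real and x :: "real^'n"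
    assume a: "1 < a" and q: "1 / a + 1 / q = 1" and r: "0 < r"
    have q': "q = a / (a - 1)"
      using a q conjugate_exponent_gt_1[OF a q] by (simp add: field_simps)
    have q0: "0 < q" using conjugate_exponent_gt_1[OF a q] by simp
    obtain Q where Q: "is_cube Q" "cball x r \<subseteq> Q" "ball x (5 * r) \<subseteq> Q"
      and mQ: "measure lebesgue Q = (10 * r) ^ CARD('n)" "emeasure lebesgue Q = ennreal ((10 * r) ^ CARD('n))"
      using ball_subset_cube[OF r] by metis
    define L where "L = (10 * r) ^ CARD('n)"
    have L0: "0 < L" using r by (simp add: L_def)
    define U where "U = (\<integral>\<^sup>+y\<in>Q. ennreal (u y) \<partial>lebesgue)"
    define V where "V = (\<integral>\<^sup>+y\<in>Q. ennreal (v y powr (1 - q)) \<partial>lebesgue)"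
    \<comment> \<open>The denominators of the two averages contribute the exponents
      \<open>- (1 / b)\<close> and \<open>- (1 / q)\<close>. With \<open>1 / a + 1 / q = 1\<close>
      the total exponent of \<open>L\<close> becomes \<open>\<beta> / n - 1\<close>, free of
      \<open>a\<close> and \<open>b\<close>.\<close>
    have "ennreal (L powr (\<beta> / n - 1)) * epowr U (1 / b) * epowr V (1 / q)
        = ennreal (L powr (1 / b + \<beta> / n - 1 / a) * L powr (- (1 / b)) * L powr (- (1 / q)))
          * epowr U (1 / b) * epowr V (1 / q)"
    proof -
      have "L powr (1 / b + \<beta> / n - 1 / a) * L powr (- (1 / b)) * L powr (- (1 / q))
          = L powr (\<beta> / n - (1 / a + 1 / q))"
        by (simp add: diff_diff_eq flip: powr_add)
      then show ?thesis by (simp add: q)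
    qed
    also have "\<dots> = ennreal (L powr (1 / b + \<beta> / n - 1 / a)) * epowr (U / ennreal L) (1 / b)
        * epowr (V / ennreal L) (1 / q)"
      using L0 by (simp add: epowr_divide_ennreal ennreal_mult mult_ac)
    also have "\<dots> \<le> ennreal C"
      using C1[OF Q(1) a] unfolding avg mQ U_def V_def L_def q' .
    finally have *: "ennreal (L powr (\<beta> / n - 1)) * epowr U (1 / b) * epowr V (1 / q) \<le> ennreal C" .
    have "ennreal (r powr (\<beta> - n)) * epowr (\<integral>\<^sup>+y\<in>ball x (5 * r). ennreal (u y) \<partial>lebesgue) (1 / b)
        * epowr (\<integral>\<^sup>+y\<in>cball x r. ennreal (v y powr (1 - q)) \<partial>lebesgue) (1 / q)
        \<le> ennreal (r powr (\<beta> - n)) * epowr U (1 / b) * epowr V (1 / q)"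
      unfolding U_def V_def using b q0 Q
      by (intro mult_mono epowr_mono nn_integral_mono_set order_refl) auto
    also have "\<dots> = ennreal D * (ennreal (L powr (\<beta> / n - 1)) * epowr U (1 / b) * epowr V (1 / q))"
      unfolding L[OF r] L_def by (simp add: mult_ac)
    also have "\<dots> \<le> ennreal D * ennreal C"
      by (intro mult_left_mono *) simp
    finally show "ennreal (r powr (\<beta> - real CARD('n)))
        * epowr (\<integral>\<^sup>+y\<in>ball x (5 * r). ennreal (u y) \<partial>lebesgue) (1 / b)
        * epowr (\<integral>\<^sup>+y\<in>cball x r. ennreal (v y powr (1 - q)) \<partial>lebesgue) (1 / q) \<le> ennreal (D * C)"
      using C D by (simp add: ennreal_mult n_def)
  next
    fix r :: real and x :: "real^'n"
    assume a: "a = 1" and r: "0 < r"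
    obtain Q where Q: "is_cube Q" "cball x r \<subseteq> Q" "ball x (5 * r) \<subseteq> Q"
      and mQ: "measure lebesgue Q = (10 * r) ^ CARD('n)" "emeasure lebesgue Q = ennreal ((10 * r) ^ CARD('n))"
      using ball_subset_cube[OF r] by metis
    define L where "L = (10 * r) ^ CARD('n)"
    have L0: "0 < L" using r by (simp add: L_def)
    define U where "U = (\<integral>\<^sup>+y\<in>Q. ennreal (u y) \<partial>lebesgue)"
    have U: "ennreal (L powr (\<beta> / n - 1)) * epowr U (1 / b)
        = ennreal (L powr (1 / b + \<beta> / n - 1)) * epowr (U / ennreal L) (1 / b)"
    proof -
      have "L powr (\<beta> / n - 1) = L powr (1 / b + \<beta> / n - 1) * L powr (- (1 / b))"
        by (simp flip: powr_add)
      then show ?thesis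
        using L0 by (simp add: epowr_divide_ennreal ennreal_mult mult_ac)
    qed
    have "ennreal (r powr (\<beta> - n)) * epowr (\<integral>\<^sup>+y\<in>ball x (5 * r). ennreal (u y) \<partial>lebesgue) (1 / b)
        \<le> ennreal (r powr (\<beta> - n)) * epowr U (1 / b)"
      unfolding U_def using b Q
      by (intro mult_mono epowr_mono nn_integral_mono_set order_refl) auto
    also have "\<dots> = ennreal D * (ennreal (L powr (1 / b + \<beta> / n - 1)) * epowr (U / ennreal L) (1 / b))"
      unfolding L[OF r] U[symmetric] by (simp add: L_def mult_ac)
    finally have le: "ennreal (r powr (\<beta> - n)) * epowr (\<integral>\<^sup>+y\<in>ball x (5 * r). ennreal (u y) \<partial>lebesgue) (1 / b)
        \<le> ennreal D * (ennreal (L powr (1 / b + \<beta> / n - 1)) * epowr (U / ennreal L) (1 / b))" .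
    show "AE y in lebesgue. y \<in> cball x r \<longrightarrow> ennreal (r powr (\<beta> - real CARD('n)))
        * epowr (\<integral>\<^sup>+y\<in>ball x (5 * r). ennreal (u y) \<partial>lebesgue) (1 / b) \<le> ennreal (D * C * v y)"
      using C2[OF Q(1) a] unfolding avg mQ
    proof eventually_elim
      case (elim y)
      show ?case
      proof
        assume "y \<in> cball x r"
        then have "ennreal (L powr (1 / b + \<beta> / n - 1)) * epowr (U / ennreal L) (1 / b) \<le> ennreal (C * v y)"
          using elim Q(2) unfolding L_def U_def by blast
        then have "ennreal D * (ennreal (L powr (1 / b + \<beta> / n - 1)) * epowr (U / ennreal L) (1 / b))
            \<le> ennreal D * ennreal (C * v y)"
          by (intro mult_left_mono) auto
        with le show "ennreal (r powr (\<beta> - real CARD('n)))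
            * epowr (\<integral>\<^sup>+y\<in>ball x (5 * r). ennreal (u y) \<partial>lebesgue) (1 / b) \<le> ennreal (D * C * v y)"
          using D unfolding n_def by (simp add: ennreal_mult' mult.assoc)
      qed
    qed
  qed
qed

text \<open>Hoelder's inequality after inserting \<open>v powr (1 / a) * v powr (- (1 / a))\<close>;
  the dual weight appears because \<open>q / a = q - 1\<close>.\<close>

lemma nn_integral_le_weighted_Holder:
  fixes g :: "'a \<Rightarrow> ennreal" and v :: "'a \<Rightarrow> real"
  assumes a: "1 < a" "1 / a + 1 / q = 1" and v: "AE x in M. 0 < v x"
    and [measurable]: "g \<in> borel_measurable M" "v \<in> borel_measurable M" "A \<in> sets M"
  shows "(\<integral>\<^sup>+x\<in>A. g x \<partial>M) \<le> epowr (\<integral>\<^sup>+x\<in>A. epowr (g x) a * ennreal (v x) \<partial>M) (1 / a)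
    * epowr (\<integral>\<^sup>+x\<in>A. ennreal (v x powr (1 - q)) \<partial>M) (1 / q)"
proof -
  have q: "1 < q" using a by (rule conjugate_exponent_gt_1)
  have "q / a = q - 1"
    using a q by (simp add: field_simps)
  then have qa: "- (1 / a) * q = 1 - q"
    by simp
  define F where "F x = g x * ennreal (v x powr (1 / a)) * indicator A x" for x
  define G where "G x = ennreal (v x powr (- (1 / a))) * indicator A x" for x
  have [measurable]: "F \<in> borel_measurable M" "G \<in> borel_measurable M"
    unfolding F_def G_def by measurable
  have "(\<integral>\<^sup>+x\<in>A. g x \<partial>M) = (\<integral>\<^sup>+x. F x * G x \<partial>M)"
    using v
  proof (intro nn_integral_cong_AE, eventually_elim)
    case (elim x)
    have "ennreal (v x powr (1 / a)) * ennreal (v x powr (- (1 / a))) = 1"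
      using elim by (simp flip: ennreal_mult powr_add)
    then show ?case
      by (auto simp: F_def G_def mult.assoc split: split_indicator)
  qed
  also have "\<dots> \<le> epowr (\<integral>\<^sup>+x. epowr (F x) a \<partial>M) (1 / a) * epowr (\<integral>\<^sup>+x. epowr (G x) q \<partial>M) (1 / q)"
    by (rule Holder_nn_integral[OF a]) measurable
  also have "(\<integral>\<^sup>+x. epowr (F x) a \<partial>M) = (\<integral>\<^sup>+x\<in>A. epowr (g x) a * ennreal (v x) \<partial>M)"
    using v by (intro nn_integral_cong_AE, eventually_elim)
      (use a in \<open>auto simp: F_def epowr_mult epowr_ennreal powr_powr split: split_indicator\<close>)
  also have "(\<integral>\<^sup>+x. epowr (G x) q \<partial>M) = (\<integral>\<^sup>+x\<in>A. ennreal (v x powr (1 - q)) \<partial>M)"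
    using qa by (intro nn_integral_cong)
      (auto simp: G_def epowr_ennreal powr_powr split: split_indicator)
  finally show ?thesis .
qed

text \<open>The right-hand side involves only the small closed ball, and this locality is what
  permits summation over disjoint balls. For \<open>a > 1\<close> the dual weight produced by
  Hoelder's inequality is absorbed by the \<open>A\<close> condition; for \<open>a = 1\<close> that
  condition is a pointwise bound by \<open>v\<close> and goes under the integral of
  \<open>g\<close>.\<close>

lemma A_class_ball_average:
  fixes u v :: "real^'n \<Rightarrow> real"
  assumes uv: "(u, v) \<in> A_class \<beta> a b" and a: "1 \<le> a" and b: "0 < b"
  shows "\<exists>C>0. \<forall>g x r. g \<in> borel_measurable lebesgue \<longrightarrow> 0 < r \<longrightarrow>
      epowr (\<integral>\<^sup>+y\<in>ball x (5 * r). ennreal (u y) \<partial>lebesgue) (1 / b)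
        * (ennreal (r powr (\<beta> - real CARD('n))) * (\<integral>\<^sup>+y\<in>ball x r. g y \<partial>lebesgue))
      \<le> ennreal C * epowr (\<integral>\<^sup>+y\<in>cball x r. epowr (g y) a * ennreal (v y) \<partial>lebesgue) (1 / a)"
proof -
  obtain C where C: "0 < C" and C1:
    "\<And>q x r. 1 < a \<Longrightarrow> 1 / a + 1 / q = 1 \<Longrightarrow> 0 < r \<Longrightarrow>
      ennreal (r powr (\<beta> - real CARD('n))) * epowr (\<integral>\<^sup>+y\<in>ball x (5 * r). ennreal (u y) \<partial>lebesgue) (1 / b)
        * epowr (\<integral>\<^sup>+y\<in>cball x r. ennreal (v y powr (1 - q)) \<partial>lebesgue) (1 / q) \<le> ennreal C"
    and C2: "\<And>x r. a = 1 \<Longrightarrow> 0 < r \<Longrightarrow>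
      AE y in lebesgue. y \<in> cball x r \<longrightarrow> ennreal (r powr (\<beta> - real CARD('n)))
        * epowr (\<integral>\<^sup>+y\<in>ball x (5 * r). ennreal (u y) \<partial>lebesgue) (1 / b) \<le> ennreal (C * v y)"
    using A_class_ball[OF uv b] by blast
  have "weight v" using uv by (auto simp: A_class_def)
  then have v: "AE x in lebesgue. 0 < v x" "\<And>x. 0 \<le> v x" and [measurable]: "v \<in> borel_measurable lebesgue"
    by (auto simp: weight_def weight_borel_measurable)
  have cball_meas [measurable]: "cball x r \<in> sets lebesgue" for x :: "real^'n" and r
    by simp
  show ?thesis
  proof (intro exI[of _ C] conjI allI impI C)
    fix g :: "real^'n \<Rightarrow> ennreal" and x :: "real^'n" and r :: real
    assume g [measurable]: "g \<in> borel_measurable lebesgue" and r: "0 < r"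
    let ?U = "epowr (\<integral>\<^sup>+y\<in>ball x (5 * r). ennreal (u y) \<partial>lebesgue) (1 / b)"
    let ?\<rho> = "ennreal (r powr (\<beta> - real CARD('n)))"
    let ?X = "\<integral>\<^sup>+y\<in>cball x r. epowr (g y) a * ennreal (v y) \<partial>lebesgue"
    have "?U * (?\<rho> * (\<integral>\<^sup>+y\<in>ball x r. g y \<partial>lebesgue)) \<le> ?U * (?\<rho> * (\<integral>\<^sup>+y\<in>cball x r. g y \<partial>lebesgue))"
      by (intro mult_left_mono nn_integral_mono_set) auto
    also have "\<dots> \<le> ennreal C * epowr ?X (1 / a)"
    proof (cases "a = 1")
      case True
      have "?U * (?\<rho> * (\<integral>\<^sup>+y\<in>cball x r. g y \<partial>lebesgue)) = (\<integral>\<^sup>+y. ?\<rho> * ?U * (g y * indicator (cball x r) y) \<partial>lebesgue)"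
        by (subst nn_integral_cmult) (auto simp: mult_ac)
      also have "\<dots> \<le> (\<integral>\<^sup>+y. ennreal (C * v y) * (g y * indicator (cball x r) y) \<partial>lebesgue)"
        using C2[OF True r, of x] by (intro nn_integral_mono_AE, eventually_elim)
          (auto split: split_indicator intro!: mult_right_mono)
      also have "\<dots> = ennreal C * (\<integral>\<^sup>+y\<in>cball x r. g y * ennreal (v y) \<partial>lebesgue)"
        using C v(2) by (simp add: ennreal_mult mult_ac flip: nn_integral_cmult)
      finally show ?thesis using True by simp
    next
      case False
      then have a1: "1 < a" using a by simp
      define q where "q = a / (a - 1)"
      have q: "1 / a + 1 / q = 1" using a1 by (simp add: q_def field_simps)
      let ?V = "epowr (\<integral>\<^sup>+y\<in>cball x r. ennreal (v y powr (1 - q)) \<partial>lebesgue) (1 / q)"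
      have "?U * (?\<rho> * (\<integral>\<^sup>+y\<in>cball x r. g y \<partial>lebesgue)) \<le> ?U * (?\<rho> * (epowr ?X (1 / a) * ?V))"
        using nn_integral_le_weighted_Holder[OF a1 q v(1)]
        by (intro mult_left_mono) auto
      also have "\<dots> = (?\<rho> * ?U * ?V) * epowr ?X (1 / a)"
        by (simp add: mult_ac)
      also have "\<dots> \<le> ennreal C * epowr ?X (1 / a)"
        by (intro mult_right_mono C1[OF a1 q r]) simp
      finally show ?thesis .
    qed
    finally show "?U * (?\<rho> * (\<integral>\<^sup>+y\<in>ball x r. g y \<partial>lebesgue)) \<le> ennreal C * epowr ?X (1 / a)" .
  qed
qed

section \<open>The covering argument and the passage to all radii\<close>

lemma emeasure_UN_countable_le:
  assumes "countable I" and [measurable]: "\<And>i. i \<in> I \<Longrightarrow> X i \<in> sets M"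
  shows "emeasure M (\<Union>i\<in>I. X i) \<le> (\<integral>\<^sup>+i. emeasure M (X i) \<partial>count_space I)"
proof -
  have "emeasure M (\<Union>i\<in>I. X i) = (\<integral>\<^sup>+x. indicator (\<Union>i\<in>I. X i) x \<partial>M)"
    using assms by (intro nn_integral_indicator[symmetric]) auto
  also have "\<dots> \<le> (\<integral>\<^sup>+x. (\<integral>\<^sup>+i. indicator (X i) x \<partial>count_space I) \<partial>M)"
  proof (intro nn_integral_mono)
    fix x
    show "indicator (\<Union>i\<in>I. X i) x \<le> (\<integral>\<^sup>+i. indicator (X i) x \<partial>count_space I)"
    proof (cases "x \<in> (\<Union>i\<in>I. X i)")
      case True
      then obtain i where "i \<in> I" "x \<in> X i" by auto
      then show ?thesis
        using nn_integral_ge_point[of i I "\<lambda>i. indicator (X i) x"] by (auto split: split_indicator)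
    qed simp
  qed
  also have "\<dots> = (\<integral>\<^sup>+i. (\<integral>\<^sup>+x. indicator (X i) x \<partial>M) \<partial>count_space I)"
    using assms by (intro nn_integral_count_space_nn_integral) auto
  also have "\<dots> = (\<integral>\<^sup>+i. emeasure M (X i) \<partial>count_space I)"
    using assms by (intro nn_integral_cong) auto
  finally show ?thesis .
qed

text \<open>A linearised form of the fact that a sum of \<open>k\<close>-th powers is at most the
  \<open>k\<close>-th power of the sum: \<open>X\<close> will be the total mass and \<open>x\<close>
  the mass of one ball. The exponent is \<open>k = b / a\<close>, so this is where
  \<open>a \<le> b\<close> is used.\<close>

lemma epowr_le_mult:
  assumes "x \<le> X" "X < top" "1 \<le> k"
  shows "epowr x k \<le> x * ennreal (enn2real X powr (k - 1))"
proof -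
  obtain y Y where xy: "x = ennreal y" "X = ennreal Y" "0 \<le> y" "y \<le> Y"
    using assms by (cases x; cases X) (auto simp: top_unique)
  show ?thesis
  proof (cases "y = 0")
    case False
    have "y powr k = y * y powr (k - 1)"
      using False xy powr_add[of y 1 "k - 1"] by simp
    also have "\<dots> \<le> y * Y powr (k - 1)"
      using xy assms by (intro mult_left_mono powr_mono2) auto
    finally show ?thesis
      using xy by (auto simp: epowr_ennreal simp flip: ennreal_mult intro!: ennreal_leI)
  qed (use xy in simp)
qed

lemma mult_powr_eq_epowr:
  assumes "X < top"
  shows "X * ennreal (enn2real X powr (k - 1)) = epowr X k"
proof -
  obtain Y where X: "X = ennreal Y" "0 \<le> Y"
    using assms by (cases X) auto
  then show ?thesis
    using powr_add[of Y 1 "k - 1"] by (cases "Y = 0") (auto simp: epowr_ennreal simp flip: ennreal_mult)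
qed

text \<open>The bound \<open>r \<le> R\<close> is what the Vitali covering lemma requires.\<close>

lemma weak_type_truncated:
  fixes u v :: "real^'n \<Rightarrow> real" and g :: "real^'n \<Rightarrow> ennreal"
  assumes ab: "1 \<le> a" "a \<le> b" and C: "0 < C" and l: "0 < l"
    and [measurable]: "u \<in> borel_measurable lebesgue" "v \<in> borel_measurable lebesgue" "g \<in> borel_measurable lebesgue"
    and ball_avg: "\<And>x r. 0 < r \<Longrightarrow>
      epowr (\<integral>\<^sup>+y\<in>ball x (5 * r). ennreal (u y) \<partial>lebesgue) (1 / b)
        * (ennreal (r powr e) * (\<integral>\<^sup>+y\<in>ball x r. g y \<partial>lebesgue))
      \<le> ennreal C * epowr (\<integral>\<^sup>+y\<in>cball x r. epowr (g y) a * ennreal (v y) \<partial>lebesgue) (1 / a)"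
    and X: "(\<integral>\<^sup>+y. epowr (g y) a * ennreal (v y) \<partial>lebesgue) < top"
  shows "\<exists>G\<in>sets lebesgue. {x. \<exists>r. 0 < r \<and> r \<le> R \<and> ennreal l < ennreal (r powr e) * (\<integral>\<^sup>+y\<in>ball x r. g y \<partial>lebesgue)} \<subseteq> G
    \<and> emeasure (density lebesgue (\<lambda>x. ennreal (u x))) G
      \<le> ennreal ((C / l) powr b) * epowr (\<integral>\<^sup>+y. epowr (g y) a * ennreal (v y) \<partial>lebesgue) (b / a)"
proof -
  define \<mu> where "\<mu> = density lebesgue (\<lambda>x. ennreal (u x))"
  define \<nu> where "\<nu> = density lebesgue (\<lambda>y. epowr (g y) a * ennreal (v y))"
  define X where "X = (\<integral>\<^sup>+y. epowr (g y) a * ennreal (v y) \<partial>lebesgue)"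
  have [measurable]: "ball x r \<in> sets lebesgue" "cball x r \<in> sets lebesgue" for x :: "real^'n" and r
    by simp_all
  have [simp]: "sets \<mu> = sets lebesgue" "sets \<nu> = sets lebesgue"
    by (simp_all add: \<mu>_def \<nu>_def)
  have \<mu>: "emeasure \<mu> (ball x r) = (\<integral>\<^sup>+y\<in>ball x r. ennreal (u y) \<partial>lebesgue)" for x r
    unfolding \<mu>_def by (rule emeasure_density) measurable
  have \<nu>: "emeasure \<nu> A = (\<integral>\<^sup>+y\<in>A. epowr (g y) a * ennreal (v y) \<partial>lebesgue)" if "A \<in> sets lebesgue" for A
    unfolding \<nu>_def using that by (intro emeasure_density) measurable
  have \<nu>X: "emeasure \<nu> A \<le> X" if "A \<in> sets lebesgue" for A
    unfolding \<nu>[OF that] X_def by (intro nn_integral_mono) (auto split: split_indicator)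
  define K where "K = {(x, r). 0 < r \<and> r \<le> R \<and> ennreal l < ennreal (r powr e) * (\<integral>\<^sup>+y\<in>ball x r. g y \<partial>lebesgue)}"
  have "\<exists>S. countable S \<and> S \<subseteq> K \<and>
      pairwise (\<lambda>i j. disjnt (cball (fst i) (snd i)) (cball (fst j) (snd j))) S \<and>
      (\<forall>i\<in>K. \<exists>j\<in>S. cball (fst i) (snd i) \<subseteq> ball (fst j) (5 * snd j))"
  proof (rule Vitali_covering_lemma_cballs_balls[of K snd R fst])
    fix i assume "i \<in> K"
    then show "0 < snd i \<and> snd i \<le> R"
      by (auto simp: K_def)
  next
    fix S assume S: "countable S" "S \<subseteq> K"
      "pairwise (\<lambda>i j. disjnt (cball (fst i) (snd i)) (cball (fst j) (snd j))) S"
      and cov: "\<And>i. i \<in> K \<Longrightarrow> \<exists>j. j \<in> S \<and> \<not> disjnt (cball (fst i) (snd i)) (cball (fst j) (snd j))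
        \<and> cball (fst i) (snd i) \<subseteq> ball (fst j) (5 * snd j)"
    have "\<forall>i\<in>K. \<exists>j\<in>S. cball (fst i) (snd i) \<subseteq> ball (fst j) (5 * snd j)"
      using cov by blast
    with S show ?thesis by (intro exI[of _ S] conjI)
  qed
  then obtain S where S: "countable S" "S \<subseteq> K"
    "pairwise (\<lambda>i j. disjnt (cball (fst i) (snd i)) (cball (fst j) (snd j))) S"
    and cover: "\<And>i. i \<in> K \<Longrightarrow> \<exists>j\<in>S. cball (fst i) (snd i) \<subseteq> ball (fst j) (5 * snd j)"
    by blast
  \<comment> \<open>A measurable set standing in for the level set, which it contains.\<close>
  define G where "G = (\<Union>j\<in>S. ball (fst j) (5 * snd j))"
  have k: "1 \<le> b / a" using ab by simp
  have ball_bound: "emeasure \<mu> (ball x (5 * r)) \<le> ennreal ((C / l) powr b) * epowr (emeasure \<nu> (cball x r)) (b / a)"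
    if "(x, r) \<in> K" for x r
  proof -
    have r: "0 < r" and lev: "ennreal l \<le> ennreal (r powr e) * (\<integral>\<^sup>+y\<in>ball x r. g y \<partial>lebesgue)"
      using that by (auto simp: K_def)
    have "epowr (emeasure \<mu> (ball x (5 * r))) (1 / b) * ennreal l
        \<le> epowr (emeasure \<mu> (ball x (5 * r))) (1 / b) * (ennreal (r powr e) * (\<integral>\<^sup>+y\<in>ball x r. g y \<partial>lebesgue))"
      using lev by (rule mult_left_mono) simp
    also have "\<dots> \<le> ennreal C * epowr (emeasure \<nu> (cball x r)) (1 / a)"
      using ball_avg[OF r] by (simp add: \<mu> \<nu>)
    \<comment> \<open>Powers of order \<open>b\<close> free the \<open>u\<close>-mass of its root
      and turn \<open>1 / a\<close> into \<open>b / a\<close>. The level is then carried to the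
      other side by the factor \<open>l powr (- b)\<close>.\<close>
    finally have "epowr (epowr (emeasure \<mu> (ball x (5 * r))) (1 / b) * ennreal l) b
        \<le> epowr (ennreal C * epowr (emeasure \<nu> (cball x r)) (1 / a)) b"
      using ab by (intro epowr_mono) auto
    then have "emeasure \<mu> (ball x (5 * r)) * ennreal (l powr b)
        \<le> ennreal (C powr b) * epowr (emeasure \<nu> (cball x r)) (b / a)"
      using ab C l by (simp add: epowr_mult epowr_epowr epowr_ennreal)
    then have "emeasure \<mu> (ball x (5 * r)) * ennreal (l powr b) * ennreal (l powr (- b))
        \<le> ennreal (C powr b) * epowr (emeasure \<nu> (cball x r)) (b / a) * ennreal (l powr (- b))"
      by (rule mult_right_mono) simp
    also have "\<dots> = (ennreal (C powr b) * ennreal (l powr (- b))) * epowr (emeasure \<nu> (cball x r)) (b / a)"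
      by (simp only: mult_ac)
    also have "ennreal (C powr b) * ennreal (l powr (- b)) = ennreal ((C / l) powr b)"
      using C l by (simp add: powr_divide powr_minus_divide flip: ennreal_mult)
    finally have "emeasure \<mu> (ball x (5 * r)) * (ennreal (l powr b) * ennreal (l powr (- b)))
        \<le> ennreal ((C / l) powr b) * epowr (emeasure \<nu> (cball x r)) (b / a)"
      by (simp only: mult.assoc)
    moreover have "ennreal (l powr b) * ennreal (l powr (- b)) = 1"
      using l by (simp flip: ennreal_mult powr_add)
    ultimately show ?thesis
      by simp
  qed
  have "emeasure \<mu> G \<le> (\<integral>\<^sup>+j. emeasure \<mu> (ball (fst j) (5 * snd j)) \<partial>count_space S)"
    unfolding G_def using S(1) by (intro emeasure_UN_countable_le) auto
  also have "\<dots> \<le> (\<integral>\<^sup>+j. ennreal ((C / l) powr b) * ennreal (enn2real X powr (b / a - 1))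
      * emeasure \<nu> (cball (fst j) (snd j)) \<partial>count_space S)"
  proof (intro nn_integral_mono)
    fix j assume "j \<in> space (count_space S)"
    then have "(fst j, snd j) \<in> K" using S(2) by auto
    then have "emeasure \<mu> (ball (fst j) (5 * snd j))
        \<le> ennreal ((C / l) powr b) * epowr (emeasure \<nu> (cball (fst j) (snd j))) (b / a)"
      by (rule ball_bound)
    also have "\<dots> \<le> ennreal ((C / l) powr b) *
        (emeasure \<nu> (cball (fst j) (snd j)) * ennreal (enn2real X powr (b / a - 1)))"
      using assms(9) k by (intro mult_left_mono epowr_le_mult \<nu>X) (auto simp: X_def)
    finally show "emeasure \<mu> (ball (fst j) (5 * snd j)) \<le> ennreal ((C / l) powr b)
        * ennreal (enn2real X powr (b / a - 1)) * emeasure \<nu> (cball (fst j) (snd j))"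
      by (simp add: mult_ac)
  qed
  also have "\<dots> = ennreal ((C / l) powr b) * ennreal (enn2real X powr (b / a - 1))
      * (\<integral>\<^sup>+j. emeasure \<nu> (cball (fst j) (snd j)) \<partial>count_space S)"
    by (rule nn_integral_cmult) simp
  \<comment> \<open>Disjointness of the selected closed balls enters here: their masses add up to
    the mass of the union, which is at most \<open>X\<close>.\<close>
  also have "(\<integral>\<^sup>+j. emeasure \<nu> (cball (fst j) (snd j)) \<partial>count_space S)
      = emeasure \<nu> (\<Union>j\<in>S. cball (fst j) (snd j))"
    using S by (intro emeasure_UN_countable[symmetric])
      (auto simp: disjoint_family_on_def pairwise_def disjnt_def)
  also have "ennreal ((C / l) powr b) * ennreal (enn2real X powr (b / a - 1)) * \<dots>
      \<le> ennreal ((C / l) powr b) * ennreal (enn2real X powr (b / a - 1)) * X"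
    using S(1) by (intro mult_left_mono \<nu>X sets.countable_UN') auto
  also have "\<dots> = ennreal ((C / l) powr b) * epowr X (b / a)"
    using mult_powr_eq_epowr[of X "b / a"] assms(9) by (simp add: X_def mult_ac)
  finally have "emeasure \<mu> G \<le> ennreal ((C / l) powr b) * epowr X (b / a)" .
  moreover have "{x. \<exists>r. 0 < r \<and> r \<le> R \<and> ennreal l < ennreal (r powr e) * (\<integral>\<^sup>+y\<in>ball x r. g y \<partial>lebesgue)} \<subseteq> G"
  proof safe
    fix x r assume r: "0 < r" "r \<le> R" "ennreal l < ennreal (r powr e) * (\<integral>\<^sup>+y\<in>ball x r. g y \<partial>lebesgue)"
    then have "(x, r) \<in> K" by (simp add: K_def)
    from cover[OF this] obtain j where "j \<in> S" "cball x r \<subseteq> ball (fst j) (5 * snd j)"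
      by auto
    moreover have "x \<in> cball x r" using r(1) by simp
    ultimately show "x \<in> G" unfolding G_def by blast
  qed
  moreover have "G \<in> sets lebesgue"
    unfolding G_def using S(1) by (intro sets.countable_UN') auto
  ultimately show ?thesis
    unfolding \<mu>_def X_def by blast
qed

text \<open>The bound for radii up to \<open>k\<close> does not depend on \<open>k\<close>, so the
  truncation can be removed. The constant precedes \<open>g\<close> and \<open>l\<close> because the
  levels will later depend on the functions.\<close>

lemma weak_type:
  fixes u v :: "real^'n \<Rightarrow> real"
  assumes uv: "(u, v) \<in> A_class \<beta> a b" and ab: "1 \<le> a" "a \<le> b"
  shows "\<exists>C>0. \<forall>g l. g \<in> borel_measurable lebesgue \<longrightarrow> 0 < l \<longrightarrow>
    (\<integral>\<^sup>+y. epowr (g y) a * ennreal (v y) \<partial>lebesgue) < top \<longrightarrow>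
    (\<exists>G\<in>sets lebesgue. {x. \<exists>r>0. ennreal l < ennreal (r powr (\<beta> - real CARD('n))) * (\<integral>\<^sup>+y\<in>ball x r. g y \<partial>lebesgue)} \<subseteq> G
      \<and> emeasure (density lebesgue (\<lambda>x. ennreal (u x))) G
        \<le> ennreal ((C / l) powr b) * epowr (\<integral>\<^sup>+y. epowr (g y) a * ennreal (v y) \<partial>lebesgue) (b / a))"
proof -
  have "weight u" "weight v" using uv by (auto simp: A_class_def)
  then have uv_meas: "u \<in> borel_measurable lebesgue" "v \<in> borel_measurable lebesgue"
    by (auto intro: weight_borel_measurable)
  have "0 < b" using ab by simp
  then obtain C where C: "0 < C" and ball_avg: "\<forall>g x r. g \<in> borel_measurable lebesgue \<longrightarrow> 0 < r \<longrightarrow>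
      epowr (\<integral>\<^sup>+y\<in>ball x (5 * r). ennreal (u y) \<partial>lebesgue) (1 / b)
        * (ennreal (r powr (\<beta> - real CARD('n))) * (\<integral>\<^sup>+y\<in>ball x r. g y \<partial>lebesgue))
      \<le> ennreal C * epowr (\<integral>\<^sup>+y\<in>cball x r. epowr (g y) a * ennreal (v y) \<partial>lebesgue) (1 / a)"
    using A_class_ball_average[OF uv ab(1)] by blast
  show ?thesis
  proof (intro exI[of _ C] conjI allI impI C)
    fix g :: "real^'n \<Rightarrow> ennreal" and l :: real
    assume g: "g \<in> borel_measurable lebesgue" and l: "0 < l"
      and X: "(\<integral>\<^sup>+y. epowr (g y) a * ennreal (v y) \<partial>lebesgue) < top"
    let ?\<mu> = "density lebesgue (\<lambda>x. ennreal (u x))"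
    let ?bd = "ennreal ((C / l) powr b) * epowr (\<integral>\<^sup>+y. epowr (g y) a * ennreal (v y) \<partial>lebesgue) (b / a)"
    let ?P = "\<lambda>x r. ennreal l < ennreal (r powr (\<beta> - real CARD('n))) * (\<integral>\<^sup>+y\<in>ball x r. g y \<partial>lebesgue)"
    have "\<exists>G\<in>sets lebesgue. {x. \<exists>r. 0 < r \<and> r \<le> real k \<and> ?P x r} \<subseteq> G \<and> emeasure ?\<mu> G \<le> ?bd" for k
      by (rule weak_type_truncated[OF ab C l uv_meas g _ X]) (use ball_avg g in blast)
    then have "\<forall>k. \<exists>G. G \<in> sets lebesgue \<and> {x. \<exists>r. 0 < r \<and> r \<le> real k \<and> ?P x r} \<subseteq> G \<and> emeasure ?\<mu> G \<le> ?bd"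
      by blast
    from choice[OF this] obtain G where "\<forall>k. G k \<in> sets lebesgue \<and>
        {x. \<exists>r. 0 < r \<and> r \<le> real k \<and> ?P x r} \<subseteq> G k \<and> emeasure ?\<mu> (G k) \<le> ?bd" ..
    then have G: "\<And>k. G k \<in> sets lebesgue" "\<And>k. {x. \<exists>r. 0 < r \<and> r \<le> real k \<and> ?P x r} \<subseteq> G k"
      "\<And>k. emeasure ?\<mu> (G k) \<le> ?bd"
      by simp_all
    \<comment> \<open>The union of the \<open>H k\<close> is the lower limit of the \<open>G k\<close>; the latter need not increase.\<close>
    define H where "H k = (\<Inter>j\<in>{k..}. G j)" for k
    have H: "H k \<in> sets lebesgue" for k
      unfolding H_def using G(1) by (intro sets.countable_INT') auto
    have "incseq H"
      unfolding H_def by (intro monoI INT_anti_mono) auto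
    then have "emeasure ?\<mu> (\<Union>k. H k) = (SUP k. emeasure ?\<mu> (H k))"
      using H by (intro SUP_emeasure_incseq[symmetric]) auto
    also have "\<dots> \<le> ?bd"
    proof (rule SUP_least)
      fix k
      have "emeasure ?\<mu> (H k) \<le> emeasure ?\<mu> (G k)"
        using G(1) by (intro emeasure_mono) (auto simp: H_def)
      then show "emeasure ?\<mu> (H k) \<le> ?bd" using G(3) order_trans by blast
    qed
    finally have "emeasure ?\<mu> (\<Union>k. H k) \<le> ?bd" .
    moreover have "{x. \<exists>r>0. ?P x r} \<subseteq> (\<Union>k. H k)"
    proof safe
      fix x r assume r: "0 < r" "?P x r"
      obtain k where k: "r \<le> real k" using real_arch_simple by blast
      have "x \<in> G j" if "k \<le> j" for j
      proof -
        have "r \<le> real j" using k that by simp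
        then show ?thesis using G(2)[of j] r by blast
      qed
      then show "x \<in> (\<Union>k. H k)" by (auto simp: H_def)
    qed
    moreover have "(\<Union>k. H k) \<in> sets lebesgue" using H by auto
    ultimately show "\<exists>G\<in>sets lebesgue. {x. \<exists>r>0. ?P x r} \<subseteq> G \<and> emeasure ?\<mu> G \<le> ?bd"
      by (intro bexI[of _ "\<Union>k. H k"] conjI)
  qed
qed

section \<open>The multilinear estimate\<close>

lemma norm_vec_le_sum_norm: "norm y \<le> (\<Sum>i\<in>UNIV. norm (y $ i))"
  unfolding norm_vec_def by (rule L2_set_le_sum) auto

text \<open>The region of integration lies both in the Euclidean ball of radius \<open>r\<close>,
  where the kernel bound applies, and in a product of balls, where the integral of the remaining
  factors splits.\<close>

lemma rough_average_le:
  fixes \<Omega> :: "real^'n^'m \<Rightarrow> complex" and f :: "'m \<Rightarrow> real^'n \<Rightarrow> complex"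
    and h :: "'m \<Rightarrow> real^'n \<Rightarrow> ennreal"
  assumes s': "1 \<le> s'" and r: "0 < r" and K: "0 < K"
    and kernel: "\<And>F. F \<in> borel_measurable borel \<Longrightarrow>
      (\<integral>\<^sup>+y\<in>ball 0 r. ennreal (norm (\<Omega> y)) * F y \<partial>lborel)
        \<le> ennreal (K * r powr (real DIM(real^'n^'m) * (1 - 1 / s'))) * epowr (\<integral>\<^sup>+y. epowr (F y) s' \<partial>lborel) (1 / s')"
    and h [measurable]: "\<And>i. h i \<in> borel_measurable borel"
    and fh: "\<And>i. AE x in lborel. ennreal (norm (f i x)) = h i x"
  shows "ennreal (1 / r powr (real CARD('m) * real CARD('n) - \<alpha>)) *
        (\<integral>\<^sup>+y\<in>{y. (\<Sum>i\<in>UNIV. norm (y $ i)) < r}.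
           ennreal (norm (\<Omega> y) * (\<Prod>i\<in>UNIV. norm (f i (x - y $ i)))) \<partial>lebesgue)
    \<le> ennreal K * epowr (\<Prod>i\<in>UNIV. ennreal (r powr (\<alpha> * s' / real CARD('m) - real CARD('n)))
          * (\<integral>\<^sup>+y\<in>ball x r. epowr (h i y) s' \<partial>lebesgue)) (1 / s')"
proof -
  let ?m = "real CARD('m)" and ?n = "real CARD('n)"
  let ?T = "{y :: real^'n^'m. (\<Sum>i\<in>UNIV. norm (y $ i)) < r}"
  have dim: "real DIM(real^'n^'m) = ?m * ?n" by simp
  have [measurable]: "?T \<in> sets borel"
    by (intro borel_open open_Collect_less continuous_intros)
  have nth [measurable]: "(\<lambda>y::real^'n^'m. y $ i) \<in> borel_measurable borel" for i
    by (intro borel_measurable_continuous_onI continuous_intros)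
  \<comment> \<open>The indicator is kept inside \<open>F\<close>, so that the original region
    survives Hoelder's inequality and can be enlarged to a product afterwards.\<close>
  define F where "F y = (\<Prod>i\<in>UNIV. h i (x - y $ i)) * indicator ?T y" for y :: "real^'n^'m"
  have F [measurable]: "F \<in> borel_measurable borel"
    unfolding F_def by measurable
  \<comment> \<open>The exceptional set of \<open>f i\<close> is reflected, translated and pulled
    back along the \<open>i\<close>-th component, and remains null.\<close>
  have ae: "AE y in lborel. \<forall>i. ennreal (norm (f i (x - (y::real^'n^'m) $ i))) = h i (x - y $ i)"
  proof -
    have "AE z in lborel. ennreal (norm (f i (x + (- 1) *\<^sub>R z))) = h i (x + (- 1) *\<^sub>R z)" for i
      using fh[of i] by (rule AE_lborel_affine) simp
    then have "AE z in lborel. ennreal (norm (f i (x - z))) = h i (x - z)" for i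
      by simp
    from AE_lborel_vec_nth[OF this] show ?thesis
      by (subst AE_all_countable) blast
  qed
  have "(\<integral>\<^sup>+y\<in>?T. ennreal (norm (\<Omega> y) * (\<Prod>i\<in>UNIV. norm (f i (x - y $ i)))) \<partial>lebesgue)
      \<le> (\<integral>\<^sup>+y\<in>ball 0 r. ennreal (norm (\<Omega> y)) * F y \<partial>lborel)"
    unfolding nn_integral_completion
    using ae
  proof (intro nn_integral_mono_AE, eventually_elim)
    case (elim y)
    have "ennreal (\<Prod>i\<in>UNIV. norm (f i (x - y $ i))) = (\<Prod>i\<in>UNIV. h i (x - y $ i))"
      using elim by (subst prod_ennreal[symmetric]) auto
    moreover have "y \<in> ball 0 r" if "y \<in> ?T"
      using that norm_vec_le_sum_norm[of y] by simp
    ultimately show ?case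
      by (auto simp: F_def ennreal_mult prod_nonneg split: split_indicator)
  qed
  also have "\<dots> \<le> ennreal (K * r powr (?m * ?n * (1 - 1 / s'))) * epowr (\<integral>\<^sup>+y. epowr (F y) s' \<partial>lborel) (1 / s')"
    using kernel[OF F] unfolding dim .
  also have "(\<integral>\<^sup>+y. epowr (F y) s' \<partial>lborel) = (\<integral>\<^sup>+y\<in>?T. (\<Prod>i\<in>UNIV. epowr (h i (x - y $ i)) s') \<partial>lborel)"
    by (intro nn_integral_cong) (auto simp: F_def epowr_prod split: split_indicator)
  also have "ennreal (K * r powr (?m * ?n * (1 - 1 / s'))) * epowr \<dots> (1 / s')
      \<le> ennreal (K * r powr (?m * ?n * (1 - 1 / s'))) *
        epowr (\<Prod>i\<in>UNIV. \<integral>\<^sup>+y\<in>ball x r. epowr (h i y) s' \<partial>lebesgue) (1 / s')"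
    unfolding nn_integral_completion using s'
    by (intro mult_left_mono epowr_mono nn_integral_prod_diff_le) auto
  finally have "ennreal (1 / r powr (?m * ?n - \<alpha>)) *
        (\<integral>\<^sup>+y\<in>?T. ennreal (norm (\<Omega> y) * (\<Prod>i\<in>UNIV. norm (f i (x - y $ i)))) \<partial>lebesgue)
      \<le> ennreal (1 / r powr (?m * ?n - \<alpha>)) * (ennreal (K * r powr (?m * ?n * (1 - 1 / s'))) *
        epowr (\<Prod>i\<in>UNIV. \<integral>\<^sup>+y\<in>ball x r. epowr (h i y) s' \<partial>lebesgue) (1 / s'))"
    by (rule mult_left_mono) simp
  also have "\<dots> = ennreal K * (ennreal (r powr (\<alpha> - ?m * ?n / s')) *
        epowr (\<Prod>i\<in>UNIV. \<integral>\<^sup>+y\<in>ball x r. epowr (h i y) s' \<partial>lebesgue) (1 / s'))"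
  proof -
    have "1 / r powr (?m * ?n - \<alpha>) * r powr (?m * ?n * (1 - 1 / s')) = r powr (\<alpha> - ?m * ?n + ?m * ?n * (1 - 1 / s'))"
      using powr_minus_divide[of r "?m * ?n - \<alpha>"] by (simp add: powr_add)
    also have "\<alpha> - ?m * ?n + ?m * ?n * (1 - 1 / s') = \<alpha> - ?m * ?n / s'"
      by (simp add: algebra_simps)
    finally have "1 / r powr (?m * ?n - \<alpha>) * (K * r powr (?m * ?n * (1 - 1 / s'))) = K * r powr (\<alpha> - ?m * ?n / s')"
      by (simp add: mult_ac)
    then have "ennreal (1 / r powr (?m * ?n - \<alpha>)) * ennreal (K * r powr (?m * ?n * (1 - 1 / s')))
        = ennreal K * ennreal (r powr (\<alpha> - ?m * ?n / s'))"
      using K by (simp flip: ennreal_mult)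
    then show ?thesis by (simp only: mult.assoc[symmetric])
  qed
  also have "ennreal (r powr (\<alpha> - ?m * ?n / s')) = epowr (\<Prod>i\<in>(UNIV::'m set). ennreal (r powr (\<alpha> * s' / ?m - ?n))) (1 / s')"
  proof -
    have "?m * (\<alpha> * s' / ?m - ?n) / s' = \<alpha> - ?m * ?n / s'"
      using s' by (simp add: field_simps)
    then have "((r powr (\<alpha> * s' / ?m - ?n)) powr ?m) powr (1 / s') = r powr (\<alpha> - ?m * ?n / s')"
      by (simp add: powr_powr mult.commute)
    then show ?thesis
      using r by (simp add: epowr_ennreal ennreal_power powr_realpow)
  qed
  finally show ?thesis
    by (simp only: prod.distrib epowr_mult)
qed

text \<open>Used in contrapositive form: a value of the left side above the product of the
  \<open>\<tau> i\<close> forces some \<open>y i\<close> above its level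
  \<open>\<tau> i powr k\<close>.\<close>

lemma epowr_prod_le:
  assumes "\<And>i. i \<in> I \<Longrightarrow> y i \<le> ennreal (\<tau> i powr k)" "\<And>i. i \<in> I \<Longrightarrow> 0 \<le> \<tau> i" "finite I" "0 < k"
  shows "epowr (\<Prod>i\<in>I. y i) (1 / k) \<le> ennreal (\<Prod>i\<in>I. \<tau> i)"
proof -
  have "(\<Prod>i\<in>I. y i) \<le> (\<Prod>i\<in>I. ennreal (\<tau> i powr k))"
    using assms(3,1) by (induction I rule: finite_induct) (auto intro: mult_mono)
  then have "epowr (\<Prod>i\<in>I. y i) (1 / k) \<le> epowr (\<Prod>i\<in>I. ennreal (\<tau> i powr k)) (1 / k)"
    using assms(4) by (intro epowr_mono) auto
  also have "\<dots> = (\<Prod>i\<in>I. ennreal (\<tau> i))"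
    using assms by (simp add: epowr_prod epowr_ennreal powr_powr)
  also have "\<dots> = ennreal (\<Prod>i\<in>I. \<tau> i)"
    using assms by (intro prod_ennreal) auto
  finally show ?thesis .
qed

theorem theorem7:
  fixes \<Omega> :: "real^'n^'m \<Rightarrow> complex"
    and u v :: "real^'n \<Rightarrow> real"
    and \<alpha> p s' :: real and s :: ennreal
    and p_exp q_exp :: "'m \<Rightarrow> real"
  assumes "CARD('n) \<ge> 2"
    and "0 < \<alpha>" and "\<alpha> < real CARD('m) * real CARD('n)"
    and "1 < s" and "1 / s + 1 / ennreal s' = 1"
    and "1 \<le> s'" and "s' < real CARD('m) * real CARD('n) / \<alpha>"
    and "homogeneous_deg_0 \<Omega>" and "\<Omega> \<in> Lp_space s sphere_measure"
    and "weight u" and "weight v"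
    and "\<And>i. s' \<le> p_exp i" and "\<And>i. p_exp i \<le> q_exp i"
    and "1 / p = (\<Sum>i\<in>UNIV. 1 / q_exp i)"
    and "(u, v) \<in> (\<Inter>i. A_class (\<alpha> * s' / real CARD('m)) (p_exp i / s') (q_exp i / s'))"
  shows "\<exists>C::real. 0 < C \<and>
    (\<forall>f :: 'm \<Rightarrow> real^'n \<Rightarrow> complex. (\<forall>i. f i \<in> weighted_Lp (p_exp i) v) \<longrightarrow>
      weighted_weak_Lp_norm p u (rough_frac_maximal \<Omega> \<alpha> f)
        \<le> ennreal C * (\<Prod>i\<in>UNIV. weighted_Lp_norm (p_exp i) v (f i)))"
proof -
  define \<beta> where "\<beta> = \<alpha> * s' / real CARD('m)"
  let ?m = "real CARD('m)" and ?n = "real CARD('n)"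
  let ?\<mu> = "density lebesgue (\<lambda>x. ennreal (u x))"
  have s': "0 < s'" "1 \<le> s'" using \<open>1 \<le> s'\<close> by auto
  have pq: "0 < p_exp i" "0 < q_exp i" for i
    using assms(12,13)[of i] s' by auto
  have p: "0 < p"
  proof -
    have "0 < (\<Sum>i\<in>(UNIV::'m set). 1 / q_exp i)"
      using pq by (intro sum_pos) auto
    then show ?thesis using \<open>1 / p = _\<close> by (metis zero_less_divide_1_iff)
  qed
  obtain K where K: "0 < K" and kernel: "\<And>r F. 0 < r \<Longrightarrow> F \<in> borel_measurable borel \<Longrightarrow>
      (\<integral>\<^sup>+y\<in>ball 0 r. ennreal (norm (\<Omega> y)) * F y \<partial>lborel)
        \<le> ennreal (K * r powr (real DIM(real^'n^'m) * (1 - 1 / s'))) * epowr (\<integral>\<^sup>+y. epowr (F y) s' \<partial>lborel) (1 / s')"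
    using rough_kernel_Holder[OF assms(8,9,4,5,6)] by blast
  let ?X = "\<lambda>i g. \<integral>\<^sup>+y. epowr (g y) (p_exp i / s') * ennreal (v y) \<partial>lebesgue"
  let ?lev = "\<lambda>l g. {x. \<exists>r>0. ennreal l < ennreal (r powr (\<beta> - ?n)) * (\<integral>\<^sup>+y\<in>ball x r. g y \<partial>lebesgue)}"
  have "\<forall>i. \<exists>C>0. \<forall>g l. g \<in> borel_measurable lebesgue \<longrightarrow> 0 < l \<longrightarrow> ?X i g < top \<longrightarrow>
    (\<exists>G\<in>sets lebesgue. ?lev l g \<subseteq> G \<and>
      emeasure ?\<mu> G \<le> ennreal ((C / l) powr (q_exp i / s')) * epowr (?X i g) (q_exp i / s' / (p_exp i / s')))"
  proof
    fix i
    have "(u, v) \<in> A_class \<beta> (p_exp i / s') (q_exp i / s')"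
      using assms(15) unfolding \<beta>_def by blast
    then show "\<exists>C>0. \<forall>g l. g \<in> borel_measurable lebesgue \<longrightarrow> 0 < l \<longrightarrow> ?X i g < top \<longrightarrow>
      (\<exists>G\<in>sets lebesgue. ?lev l g \<subseteq> G \<and>
        emeasure ?\<mu> G \<le> ennreal ((C / l) powr (q_exp i / s')) * epowr (?X i g) (q_exp i / s' / (p_exp i / s')))"
      by (rule weak_type) (use assms(12,13)[of i] s' in \<open>auto simp: divide_right_mono\<close>)
  qed
  from choice[OF this] obtain C where C: "\<And>i. 0 < C i" and weak:
    "\<And>i g l. g \<in> borel_measurable lebesgue \<Longrightarrow> 0 < l \<Longrightarrow> ?X i g < top \<Longrightarrow>
    (\<exists>G\<in>sets lebesgue. ?lev l g \<subseteq> G \<and>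
      emeasure ?\<mu> G \<le> ennreal ((C i / l) powr (q_exp i / s')) * epowr (?X i g) (q_exp i / s' / (p_exp i / s')))"
    by meson
  \<comment> \<open>The weak-type bound concerns \<open>s'\<close>-th powers at levels
    \<open>\<tau> powr s'\<close>; this root restores the scale of the functions themselves.\<close>
  define c where "c i = C i powr (1 / s')" for i
  have c: "0 < c i" for i using C[of i] by (simp add: c_def)
  \<comment> \<open>\<open>K\<close> is the kernel constant, the \<open>c i\<close> come from the
    weak-type bounds, and \<open>?m powr (1 / p)\<close> from adding \<open>m\<close> sets of equal
    bound before the \<open>p\<close>-th root.\<close>
  define B where "B = ?m powr (1 / p) * K * (\<Prod>i\<in>UNIV. c i)"
  show ?thesis
  proof (intro exI[of _ B] conjI allI impI)
    show "0 < B"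
      using K c by (auto simp: B_def intro!: mult_pos_pos prod_pos)
    fix f :: "'m \<Rightarrow> real^'n \<Rightarrow> complex"
    assume f: "\<forall>i. f i \<in> weighted_Lp (p_exp i) v"
    have "\<exists>h\<in>borel_measurable lborel. AE x in lborel. ennreal (norm (f i x)) = h x" for i
    proof (rule completion_ex_borel_measurable)
      have "f i \<in> borel_measurable lebesgue" using f by (auto simp: weighted_Lp_def)
      then show "(\<lambda>x. ennreal (norm (f i x))) \<in> borel_measurable lebesgue" by measurable
    qed
    then obtain h where h_lborel: "\<And>i. h i \<in> borel_measurable lborel"
      and fh: "\<And>i. AE x in lborel. ennreal (norm (f i x)) = h i x"
      by metis
    then have h [measurable]: "\<And>i. h i \<in> borel_measurable borel" by simp
    define g where "g i y = epowr (h i y) s'" for i y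
    have g: "g i \<in> borel_measurable lebesgue" for i
    proof -
      have "g i \<in> borel_measurable lborel" unfolding g_def by measurable
      then show ?thesis by (rule measurable_completion)
    qed
    define A where "A i = enn2real (weighted_Lp_norm (p_exp i) v (f i))" for i
    have A: "weighted_Lp_norm (p_exp i) v (f i) = ennreal (A i)" "0 \<le> A i" for i
      using f by (auto simp: A_def weighted_Lp_def less_top)
    have v: "\<And>x. 0 \<le> v x" "AE x in lebesgue. 0 < v x"
      using \<open>weight v\<close> by (auto simp: weight_def)
    have X: "epowr (?X i (g i)) (1 / p_exp i) = ennreal (A i)" for i
    proof -
      have "AE x in lborel. epowr (g i x) (p_exp i / s') * ennreal (v x) = ennreal (norm (f i x) powr p_exp i * v x)"
        using fh[of i]
      proof eventually_elim
        fix x assume "ennreal (norm (f i x)) = h i x"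
        then have "h i x = ennreal (norm (f i x))" ..
        then show "epowr (g i x) (p_exp i / s') * ennreal (v x) = ennreal (norm (f i x) powr p_exp i * v x)"
          using v(1)[of x] s' by (simp add: g_def epowr_ennreal powr_powr ennreal_mult)
      qed
      then have "?X i (g i) = (\<integral>\<^sup>+x. ennreal (norm (f i x) powr p_exp i * v x) \<partial>lebesgue)"
        unfolding nn_integral_completion by (rule nn_integral_cong_AE)
      then show ?thesis using A(1)[of i] by (simp add: weighted_Lp_norm_def)
    qed
    have X_top: "?X i (g i) < top" for i
      using X[of i] epowr_eq_top_iff[of "?X i (g i)" "1 / p_exp i"] by (auto simp: less_top)
    have X_powr: "epowr (?X i (g i)) (q_exp i / s' / (p_exp i / s')) = ennreal (A i powr q_exp i)" for i
    proof -
      have "epowr (?X i (g i)) (q_exp i / s' / (p_exp i / s')) = epowr (epowr (?X i (g i)) (1 / p_exp i)) (q_exp i)"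
        using s' by (simp add: epowr_epowr)
      then show ?thesis by (simp add: X A epowr_ennreal)
    qed
    let ?avg = "\<lambda>i x r. ennreal (r powr (\<beta> - ?n)) * (\<integral>\<^sup>+y\<in>ball x r. g i y \<partial>lebesgue)"
    have pointwise: "\<exists>r>0. ennreal t < ennreal K * epowr (\<Prod>i\<in>UNIV. ?avg i x r) (1 / s')"
      if large: "ennreal t < rough_frac_maximal \<Omega> \<alpha> f x" for t x
    proof -
      obtain r where "0 < r" and r: "ennreal t < ennreal (1 / r powr (?m * ?n - \<alpha>)) *
          (\<integral>\<^sup>+y\<in>{y. (\<Sum>i\<in>UNIV. norm (y $ i)) < r}.
             ennreal (norm (\<Omega> y) * (\<Prod>i\<in>UNIV. norm (f i (x - y $ i)))) \<partial>lebesgue)"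
        using large unfolding rough_frac_maximal_def less_SUP_iff by auto
      note r
      also note rough_average_le[OF s'(2) \<open>0 < r\<close> K kernel[OF \<open>0 < r\<close>] h fh, where \<alpha> = \<alpha> and x = x]
      finally show ?thesis
        using \<open>0 < r\<close> unfolding g_def \<beta>_def by blast
    qed
    have "ennreal t * epowr (\<integral>\<^sup>+x\<in>{x. rough_frac_maximal \<Omega> \<alpha> f x > ennreal t}. ennreal (u x) \<partial>lebesgue) (1 / p)
        \<le> ennreal (B * (\<Prod>i\<in>UNIV. A i))" if t: "0 < t" for t
    proof (cases "\<exists>i. A i = 0")
      \<comment> \<open>A zero norm would give a zero level, which the weak-type bound does not
        admit. Here \<open>g i\<close> vanishes almost everywhere, so do all its averages, and the
        level set is empty.\<close>
      case True
      then obtain i where i: "A i = 0" by blast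
      have "?X i (g i) = 0" using X[of i] i by simp
      moreover have [measurable]: "v \<in> borel_measurable lebesgue" "g i \<in> borel_measurable lebesgue"
        using weight_borel_measurable[OF \<open>weight v\<close>] g by auto
      have "(\<lambda>y. epowr (g i y) (p_exp i / s') * ennreal (v y)) \<in> borel_measurable lebesgue"
        by measurable
      ultimately have "AE y in lebesgue. epowr (g i y) (p_exp i / s') * ennreal (v y) = 0"
        using nn_integral_0_iff_AE by blast
      then have "AE y in lebesgue. g i y = 0"
        using v(2) by eventually_elim auto
      then have "AE y in lebesgue. g i y * indicator (ball x r) y = 0" for x r
        by eventually_elim simp
      then have "(\<integral>\<^sup>+y\<in>ball x r. g i y \<partial>lebesgue) = (\<integral>\<^sup>+y. 0 \<partial>(lebesgue :: (real^'n) measure))" for x r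
        by (rule nn_integral_cong_AE)
      then have "?avg i x r = 0" for x r
        by simp
      then have zero: "(\<Prod>j\<in>UNIV. ?avg j x r) = 0" for x r
        by (intro prod_zero) auto
      have "\<not> ennreal t < rough_frac_maximal \<Omega> \<alpha> f x" for x
        using pointwise[of t x] unfolding zero by auto
      then have "{x. rough_frac_maximal \<Omega> \<alpha> f x > ennreal t} = {}"
        by blast
      then show ?thesis by simp
    next
      case False
      then have A0: "0 < A i" for i using A(2)[of i] by (simp add: less_le)
      define P where "P = (\<Prod>i\<in>UNIV. c i * A i)"
      have P: "0 < P" unfolding P_def using c A0 by (intro prod_pos) auto
      \<comment> \<open>Chosen so that all the sets \<open>G i\<close> below receive the same bound \<open>\<theta>\<close>.\<close>
      define \<theta> where "\<theta> = (K * P / t) powr p"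
      have \<theta>: "0 < \<theta>" using K P t by (simp add: \<theta>_def)
      \<comment> \<open>The solution of
        \<open>(c i * A i / \<tau> i) powr q_exp i = \<theta>\<close>.\<close>
      define \<tau> where "\<tau> i = c i * A i * \<theta> powr (- (1 / q_exp i))" for i
      have \<tau>: "0 < \<tau> i" for i using c A0 \<theta> by (simp add: \<tau>_def)
      \<comment> \<open>The exponents \<open>1 / q_exp i\<close> add up to \<open>1 / p\<close>, so
        the product is \<open>P * \<theta> powr (- (1 / p))\<close>; the value of
        \<open>\<theta>\<close> is the one for which this equals \<open>t / K\<close>.\<close>
      have prod_\<tau>: "(\<Prod>i\<in>UNIV. \<tau> i) = t / K"
      proof -
        have "(\<Prod>i\<in>UNIV. \<tau> i) = P * \<theta> powr (\<Sum>i\<in>UNIV. - (1 / q_exp i))"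
          using \<theta> unfolding \<tau>_def P_def by (simp add: prod.distrib powr_sum)
        also have "(\<Sum>i\<in>UNIV. - (1 / q_exp i)) = - (1 / p)"
          using assms(14) by (simp add: sum_negf)
        also have "\<theta> powr (- (1 / p)) = t / (K * P)"
          using p K P t by (simp add: \<theta>_def powr_powr powr_minus_divide)
        finally show ?thesis using P by simp
      qed
      have "\<forall>i. \<exists>G. G \<in> sets lebesgue \<and> ?lev (\<tau> i powr s') (g i) \<subseteq> G \<and> emeasure ?\<mu> G \<le> ennreal \<theta>"
      proof
        fix i
        have "(C i / \<tau> i powr s') powr (q_exp i / s') = (c i / \<tau> i) powr q_exp i"
        proof -
          have "C i = c i powr s'" using C[of i] s' by (simp add: c_def powr_powr)
          then have "C i / \<tau> i powr s' = (c i / \<tau> i) powr s'"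
            using c \<tau> by (simp add: powr_divide less_imp_le)
          then show ?thesis using s' by (simp add: powr_powr)
        qed
        then have "ennreal ((C i / \<tau> i powr s') powr (q_exp i / s')) * ennreal (A i powr q_exp i)
            = ennreal ((c i / \<tau> i * A i) powr q_exp i)"
          using powr_mult[of "c i / \<tau> i" "A i" "q_exp i"] c[of i] \<tau>[of i] A0[of i]
          by (simp flip: ennreal_mult)
        also have "c i / \<tau> i * A i = \<theta> powr (1 / q_exp i)"
          using c[of i] A0[of i] \<theta> by (simp add: \<tau>_def powr_minus_divide)
        also have "(\<theta> powr (1 / q_exp i)) powr q_exp i = \<theta>"
          using pq[of i] \<theta> by (simp add: powr_powr)
        finally have "ennreal ((C i / \<tau> i powr s') powr (q_exp i / s')) * ennreal (A i powr q_exp i) = ennreal \<theta>" .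
        then show "\<exists>G. G \<in> sets lebesgue \<and> ?lev (\<tau> i powr s') (g i) \<subseteq> G \<and> emeasure ?\<mu> G \<le> ennreal \<theta>"
          using weak[OF g _ X_top[of i], of "\<tau> i powr s'"] \<tau>[of i] unfolding X_powr by auto
      qed
      from choice[OF this] obtain G where "\<forall>i. G i \<in> sets lebesgue \<and>
          ?lev (\<tau> i powr s') (g i) \<subseteq> G i \<and> emeasure ?\<mu> (G i) \<le> ennreal \<theta>" ..
      then have G: "\<And>i. G i \<in> sets lebesgue" "\<And>i. ?lev (\<tau> i powr s') (g i) \<subseteq> G i"
        "\<And>i. emeasure ?\<mu> (G i) \<le> ennreal \<theta>"
        by simp_all
      have sub: "{x. rough_frac_maximal \<Omega> \<alpha> f x > ennreal t} \<subseteq> (\<Union>i. G i)"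
      proof (rule subsetI, rule ccontr)
        fix x assume "x \<in> {x. rough_frac_maximal \<Omega> \<alpha> f x > ennreal t}" "x \<notin> (\<Union>i. G i)"
        then have x: "ennreal t < rough_frac_maximal \<Omega> \<alpha> f x" "\<And>i. x \<notin> G i" by simp_all
        from pointwise[OF x(1)] obtain r
          where r: "0 < r" "ennreal t < ennreal K * epowr (\<Prod>i\<in>UNIV. ?avg i x r) (1 / s')"
          by (elim exE conjE)
        \<comment> \<open>Lying outside every \<open>G i\<close> bounds the averages at every
          radius, in particular all of them at the common radius \<open>r\<close>.\<close>
        have "?avg i x r \<le> ennreal (\<tau> i powr s')" for i
        proof (rule ccontr)
          assume "\<not> ?thesis"
          then have "ennreal (\<tau> i powr s') < ?avg i x r" by simp
          then have "x \<in> ?lev (\<tau> i powr s') (g i)"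
            using r(1) by (intro CollectI exI[of _ r] conjI)
          then show False using G(2)[of i] x(2)[of i] by (auto dest: subsetD)
        qed
        then have "epowr (\<Prod>i\<in>UNIV. ?avg i x r) (1 / s') \<le> ennreal (t / K)"
          unfolding prod_\<tau>[symmetric] using \<tau> s' by (intro epowr_prod_le) (auto intro: less_imp_le)
        then have "ennreal K * epowr (\<Prod>i\<in>UNIV. ?avg i x r) (1 / s') \<le> ennreal K * ennreal (t / K)"
          by (rule mult_left_mono) simp
        also have "\<dots> = ennreal t" using K t by (simp flip: ennreal_mult)
        finally show False using r(2) by simp
      qed
      have "(\<integral>\<^sup>+x\<in>{x. rough_frac_maximal \<Omega> \<alpha> f x > ennreal t}. ennreal (u x) \<partial>lebesgue)
          \<le> (\<integral>\<^sup>+x\<in>(\<Union>i. G i). ennreal (u x) \<partial>lebesgue)"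
        using sub by (rule nn_integral_mono_set)
      also have "\<dots> = emeasure ?\<mu> (\<Union>i. G i)"
        using G(1) weight_borel_measurable[OF \<open>weight u\<close>] by (intro emeasure_density[symmetric]) auto
      also have "\<dots> \<le> (\<Sum>i\<in>UNIV. emeasure ?\<mu> (G i))"
        using G(1) by (intro emeasure_subadditive_finite) auto
      also have "\<dots> \<le> (\<Sum>i\<in>(UNIV::'m set). ennreal \<theta>)"
        by (intro sum_mono G)
      also have "\<dots> = ennreal (?m * \<theta>)"
        using \<theta> by (simp add: ennreal_mult ennreal_of_nat_eq_real_of_nat)
      finally have "ennreal t * epowr (\<integral>\<^sup>+x\<in>{x. rough_frac_maximal \<Omega> \<alpha> f x > ennreal t}. ennreal (u x) \<partial>lebesgue) (1 / p)
          \<le> ennreal t * epowr (ennreal (?m * \<theta>)) (1 / p)"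
        using p by (intro mult_left_mono epowr_mono) auto
      also have "\<dots> = ennreal (t * (?m powr (1 / p) * \<theta> powr (1 / p)))"
        using \<theta> t by (simp add: epowr_ennreal powr_mult flip: ennreal_mult)
      \<comment> \<open>Since \<open>\<theta> powr (1 / p) = K * P / t\<close>, the level
        \<open>t\<close> cancels and the bound is uniform in it.\<close>
      also have "t * (?m powr (1 / p) * \<theta> powr (1 / p)) = B * (\<Prod>i\<in>UNIV. A i)"
        using p K P t by (simp add: \<theta>_def powr_powr B_def P_def prod.distrib)
      finally show ?thesis .
    qed
    then have "weighted_weak_Lp_norm p u (rough_frac_maximal \<Omega> \<alpha> f) \<le> ennreal (B * (\<Prod>i\<in>UNIV. A i))"
      unfolding weighted_weak_Lp_norm_def by (intro SUP_least) auto
    also have "\<dots> = ennreal B * (\<Prod>i\<in>UNIV. weighted_Lp_norm (p_exp i) v (f i))"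
      using \<open>0 < B\<close> A(2) by (simp add: A(1) ennreal_mult prod_nonneg prod_ennreal)
    finally show "weighted_weak_Lp_norm p u (rough_frac_maximal \<Omega> \<alpha> f)
        \<le> ennreal B * (\<Prod>i\<in>UNIV. weighted_Lp_norm (p_exp i) v (f i))" .
  qed
qed

end
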